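(* For any $\delta\in(0,1)$ there exists $c_\delta>0$ depending only on $\delta$ such that the following holds for all integers $N\ge1$, $p\ge2$, $1\le s\le p$. Assume that $\mathbb X$ is an $N\times p$ matrix with i.i.d. standard normal entries and that $\boldsymbol\xi$ is an i.i.d. standard normal noise vector independent of $\mathbb X$. Then $$\inf_\Delta R(\Delta,p,N,s,\rho)\ge\delta\quad\text{for all } 0<\rho\le c_\delta\min\Big(\sqrt{\frac{s\log(1+\sqrt p/s)}N},1\Big),$$ where $\inf_\Delta$ is the infimum over all tests. As a consequence, $$\rho_*(p,N,s,\delta)\ge c_\delta\min\Big(\sqrt{\frac{s\log(1+\sqrt p/s)}N},1\Big),$$ and the minimax rate $\phi_*$ of estimation of $\|\boldsymbol\theta\|_2$ satisfies $\phi_*(p,N,s,\sigma,\delta)\ge\frac{c_\delta}2\sigma\min\Big(\sqrt{\frac{s\log(1+\sqrt p/s)}N},1\Big)$, i.e. $$\inf_{\hat T}\sup_{\sigma>0}\sup_{\boldsymbol\theta\in B_0(s)}\mathbf P_{\boldsymbol\theta,\sigma}\Big(\big|\hat T-\|\boldsymbol\theta\|_2\big|>\frac{c_\delta}2\,\sigma\min\Big(\sqrt{\frac{s\log(1+\sqrt p/s)}N},1\Big)\Big)\ge\delta,$$ where $\inf_{\hat T}$ is the infimum over all estimators.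
   Context: Model: one observes $(\mathbb X,\mathbf Y)$ with $\mathbf Y=\mathbb X\boldsymbol\theta+\sigma\boldsymbol\xi$, where $\boldsymbol\theta\in\mathbb R^p$ and $\sigma>0$ are unknown. $\mathbf P_{\boldsymbol\theta,\sigma}$ is the law of $(\mathbb X,\mathbf Y)$. $B_0(s)$ is the set of vectors in $\mathbb R^p$ with at most $s$ nonzero components. A test $\Delta=\Delta(\mathbb X,\mathbf Y)$ is a measurable function of $(\mathbb X,\mathbf Y)$ with values in $\{0,1\}$; an estimator is a measurable function of $(\mathbb X,\mathbf Y)$ (not depending on $\boldsymbol\theta,\sigma$). The risk of a test is $$R(\Delta,p,N,s,\rho)=\sup_{\sigma>0}\mathbf P_{\mathbf 0,\sigma}(\Delta=1)+\sup_{\sigma>0}\ \sup_{\boldsymbol\theta\in B_0(s),\,\|\boldsymbol\theta\|_2\ge\sigma\rho}\mathbf P_{\boldsymbol\theta,\sigma}(\Delta=0),$$ and the minimax separation rate is $\rho_*(p,N,s,\delta)=\inf\{\rho>0:\ \inf_{\Delta}R(\Delta,p,N,s,\rho)\le\delta\}$. *)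

theory Defs
  imports "HOL-Probability.Probability"
begin

text \<open>
  The dimensions vary inside the statement, so vectors are extensional functions on
  \<^term>\<open>{..<n}\<close> and matrices are extensional functions on index pairs, with indices starting
  at \<^term>\<open>0::nat\<close>.
\<close>

definition std_normal :: "real measure" where
  "std_normal = density lborel (\<lambda>x. ennreal (std_normal_density x))"

definition obs_space ::
  "nat \<Rightarrow> nat \<Rightarrow> ((nat \<times> nat \<Rightarrow> real) \<times> (nat \<Rightarrow> real)) measure" where
  "obs_space N p =
     (\<Pi>\<^sub>M ij\<in>{..<N} \<times> {..<p}. borel) \<Otimes>\<^sub>M (\<Pi>\<^sub>M i\<in>{..<N}. borel)"

definition design_noise ::
  "nat \<Rightarrow> nat \<Rightarrow> ((nat \<times> nat \<Rightarrow> real) \<times> (nat \<Rightarrow> real)) measure" where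
  "design_noise N p =
     (\<Pi>\<^sub>M ij\<in>{..<N} \<times> {..<p}. std_normal) \<Otimes>\<^sub>M (\<Pi>\<^sub>M i\<in>{..<N}. std_normal)"

definition response ::
  "nat \<Rightarrow> nat \<Rightarrow> (nat \<Rightarrow> real) \<Rightarrow> real \<Rightarrow> (nat \<times> nat \<Rightarrow> real) \<Rightarrow> (nat \<Rightarrow> real) \<Rightarrow> nat \<Rightarrow> real" where
  "response N p \<theta> \<sigma> X \<xi> = (\<lambda>i\<in>{..<N}. (\<Sum>j<p. X (i, j) * \<theta> j) + \<sigma> * \<xi> i)"

definition model_law ::
  "nat \<Rightarrow> nat \<Rightarrow> (nat \<Rightarrow> real) \<Rightarrow> real \<Rightarrow> ((nat \<times> nat \<Rightarrow> real) \<times> (nat \<Rightarrow> real)) measure" where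
  "model_law N p \<theta> \<sigma> =
     distr (design_noise N p) (obs_space N p) (\<lambda>(X, \<xi>). (X, response N p \<theta> \<sigma> X \<xi>))"

definition zero_vec :: "nat \<Rightarrow> nat \<Rightarrow> real" where
  "zero_vec p = (\<lambda>j\<in>{..<p}. 0)"

definition B0 :: "nat \<Rightarrow> nat \<Rightarrow> (nat \<Rightarrow> real) set" where
  "B0 p s = {\<theta> \<in> {..<p} \<rightarrow>\<^sub>E UNIV. card {j \<in> {..<p}. \<theta> j \<noteq> 0} \<le> s}"

definition vnorm :: "nat \<Rightarrow> (nat \<Rightarrow> real) \<Rightarrow> real" where
  "vnorm p \<theta> = L2_set \<theta> {..<p}"

definition tests :: "nat \<Rightarrow> nat \<Rightarrow> ((nat \<times> nat \<Rightarrow> real) \<times> (nat \<Rightarrow> real) \<Rightarrow> nat) set" where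
  "tests N p = measurable (obs_space N p) (count_space {0, 1})"

definition estimators :: "nat \<Rightarrow> nat \<Rightarrow> ((nat \<times> nat \<Rightarrow> real) \<times> (nat \<Rightarrow> real) \<Rightarrow> real) set" where
  "estimators N p = borel_measurable (obs_space N p)"

definition risk ::
  "((nat \<times> nat \<Rightarrow> real) \<times> (nat \<Rightarrow> real) \<Rightarrow> nat) \<Rightarrow> nat \<Rightarrow> nat \<Rightarrow> nat \<Rightarrow> real \<Rightarrow> ennreal" where
  "risk \<Delta> p N s \<rho> =
     (SUP \<sigma>\<in>{0<..}. emeasure (model_law N p (zero_vec p) \<sigma>) {z \<in> space (obs_space N p). \<Delta> z = 1})
   + (SUP \<sigma>\<in>{0<..}. SUP \<theta>\<in>{\<theta> \<in> B0 p s. vnorm p \<theta> \<ge> \<sigma> * \<rho>}.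
        emeasure (model_law N p \<theta> \<sigma>) {z \<in> space (obs_space N p). \<Delta> z = 0})"

definition minimax_test_risk :: "nat \<Rightarrow> nat \<Rightarrow> nat \<Rightarrow> real \<Rightarrow> ennreal" where
  "minimax_test_risk p N s \<rho> = (INF \<Delta>\<in>tests N p. risk \<Delta> p N s \<rho>)"

text \<open>
  The separation rate lives in \<^typ>\<open>ennreal\<close> because the set of admissible radii may be
  empty (for instance when \<^term>\<open>N = (1::nat)\<close> and \<^term>\<open>\<delta> < (1::real)\<close>); its infimum is then infinite.
\<close>

definition separation_rate :: "nat \<Rightarrow> nat \<Rightarrow> nat \<Rightarrow> real \<Rightarrow> ennreal" where
  "separation_rate p N s \<delta> =
     (INF \<rho>\<in>{\<rho>. 0 < \<rho> \<and> minimax_test_risk p N s \<rho> \<le> ennreal \<delta>}. ennreal \<rho>)"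

definition minimax_estimation_error :: "nat \<Rightarrow> nat \<Rightarrow> nat \<Rightarrow> real \<Rightarrow> ennreal" where
  "minimax_estimation_error p N s r =
     (INF T\<in>estimators N p. SUP \<sigma>\<in>{0<..}. SUP \<theta>\<in>B0 p s.
        emeasure (model_law N p \<theta> \<sigma>) {z \<in> space (obs_space N p). \<bar>T z - vnorm p \<theta>\<bar> > \<sigma> * r})"

definition rate :: "nat \<Rightarrow> nat \<Rightarrow> nat \<Rightarrow> real" where
  "rate p N s = min (sqrt (real s * ln (1 + sqrt (real p) / real s) / real N)) 1"

lemma prob_space_model_law: "prob_space (model_law N p \<theta> \<sigma>)"
proof -
  have sn: "prob_space std_normal"
    unfolding std_normal_def by (rule prob_space_normal_density) simp
  have [measurable_cong]: "sets std_normal = sets borel"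
    by (simp add: std_normal_def)
  have "prob_space (design_noise N p)"
    unfolding design_noise_def
    by (intro prob_space_pair prob_space_PiM sn)
  moreover have "(\<lambda>(X, \<xi>). (X, response N p \<theta> \<sigma> X \<xi>)) \<in> measurable (design_noise N p) (obs_space N p)"
    unfolding design_noise_def obs_space_def response_def
    by measurable
  ultimately show ?thesis
    unfolding model_law_def by (rule prob_space.prob_space_distr)
qed

end

theory Submission imports Defs begin

text \<open>
  Compare \<open>\<theta> = 0, \<sigma> = 1\<close> with alternatives \<open>\<parallel>\<theta>\<parallel> = r, \<sigma> = sqrt (1 - r\<^sup>2)\<close>, for which every
  response is marginally standard normal, just as under the null. For \<open>\<theta>\<close> and \<open>\<theta>'\<close> constant on
  their supports \<open>S\<close> and \<open>T\<close>, the likelihood ratios satisfy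
  \<open>E (L\<^sub>S L\<^sub>T) = (1 - r\<^sup>2 |S \<inter> T| / |S|)^(-N)\<close>. The prior cuts the coordinates into \<open>t = min s \<lfloor>sqrt p\<rfloor>\<close>
  blocks and puts one nonzero entry uniformly into each, so that \<open>|S \<inter> T|\<close> is binomial; the
  \<open>\<chi>\<^sup>2\<close>-divergence of the mixture from the null is then arbitrarily small once \<open>r\<close> is a small multiple
  of the rate. Capping the sparsity at \<open>sqrt p\<close> costs a constant only, because
  \<open>s ln (1 + sqrt p / s)\<close> is at most \<open>sqrt p\<close>.

  Two hypotheses bound the estimation error by about \<open>1/2\<close> only. To reach an arbitrary \<open>\<delta> < 1\<close>, an
  estimator is confronted with many equally spaced radii, each indistinguishable from the null.
\<close>

section \<open>Gaussian integrals in one variable\<close>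

lemma prob_space_std_normal: "prob_space std_normal"
  unfolding std_normal_def by (rule prob_space_normal_density) simp

lemma sets_std_normal [simp, measurable_cong]: "sets std_normal = sets borel"
  by (simp add: std_normal_def)

lemma space_std_normal [simp]: "space std_normal = UNIV"
  by (simp add: std_normal_def)

interpretation std_normal: prob_space std_normal
  by (rule prob_space_std_normal)

interpretation gauss: product_sigma_finite "\<lambda>_. std_normal"
  by unfold_locales

lemma prob_space_gauss_PiM: "prob_space (PiM I (\<lambda>_. std_normal))"
  by (intro prob_space_PiM prob_space_std_normal)

lemma normal_density_shift: "normal_density (c + d) \<tau> y = normal_density 0 \<tau> (y - c - d)"
  by (simp add: normal_density_def algebra_simps)

lemma borel_measurable_normal_density' [measurable]:
  assumes [measurable]: "f \<in> borel_measurable M" "g \<in> borel_measurable M"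
  shows "(\<lambda>x. normal_density (f x) \<tau> (g x)) \<in> borel_measurable M"
  unfolding normal_density_def by measurable

text \<open>Variances add: averaging the density of N(\<open>c + w * z\<close>,
  \<open>\<tau>\<^sup>2\<close>) over a standard normal \<open>z\<close> convolves two centred
  normal densities. The weight \<open>w\<close> may have either sign, so the second one has
  deviation \<open>\<bar>w\<bar>\<close>.\<close>

lemma nn_integral_normal_density_std_normal:
  assumes "0 < \<tau>"
  shows "(\<integral>\<^sup>+z. ennreal (normal_density (c + w * z) \<tau> y) \<partial>std_normal)
    = ennreal (normal_density c (sqrt (\<tau>\<^sup>2 + w\<^sup>2)) y)"
proof (cases "w = 0")
  \<comment> \<open>For \<open>w = 0\<close> the law of \<open>w * z\<close> is a point mass, which
    has no density to convolve with.\<close>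
  case True
  then show ?thesis
    using assms by (simp add: std_normal.emeasure_space_1[simplified])
next
  case False
  have "(\<integral>\<^sup>+z. ennreal (normal_density (c + w * z) \<tau> y) \<partial>std_normal)
      = (\<integral>\<^sup>+z. ennreal (normal_density 0 1 z) * ennreal (normal_density (c + w * z) \<tau> y) \<partial>lborel)"
    unfolding std_normal_def by (subst nn_integral_density) auto
  \<comment> \<open>Writing the standard normal density at \<open>z\<close> as
    \<open>\<bar>w\<bar>\<close> times a density at \<open>w * z\<close> supplies the Jacobian of
    the substitution \<open>t = w * z\<close>.\<close>
  also have "\<dots> = (\<integral>\<^sup>+z. ennreal \<bar>w\<bar> * ennreal (normal_density 0 \<tau> (y - c - (0 + w * z))
      * normal_density 0 \<bar>w\<bar> (0 + w * z)) \<partial>lborel)"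
  proof (rule nn_integral_cong)
    fix z :: real
    have "sqrt (2 * pi * w\<^sup>2) = \<bar>w\<bar> * sqrt (2 * pi)"
      by (simp add: real_sqrt_mult)
    then have "\<bar>w\<bar> * normal_density 0 \<bar>w\<bar> (w * z) = normal_density 0 1 z"
      using False by (simp add: normal_density_def power_mult_distrib field_simps)
    then show "ennreal (normal_density 0 1 z) * ennreal (normal_density (c + w * z) \<tau> y) =
       ennreal \<bar>w\<bar> * ennreal (normal_density 0 \<tau> (y - c - (0 + w * z))
      * normal_density 0 \<bar>w\<bar> (0 + w * z))"
      by (simp add: ennreal_mult'[symmetric] normal_density_shift mult_ac)
  qed
  also have "\<dots> = ennreal \<bar>w\<bar> * (\<integral>\<^sup>+z. ennreal (normal_density 0 \<tau> (y - c - (0 + w * z))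
      * normal_density 0 \<bar>w\<bar> (0 + w * z)) \<partial>lborel)"
    by (rule nn_integral_cmult) measurable
  also have "\<dots> = (\<integral>\<^sup>+t. ennreal (normal_density 0 \<tau> (y - c - t)
      * normal_density 0 \<bar>w\<bar> t) \<partial>lborel)"
    by (rule nn_integral_real_affine[symmetric]) (use False in auto)
  also have "\<dots> = ennreal (normal_density 0 (sqrt (\<tau>\<^sup>2 + \<bar>w\<bar>\<^sup>2)) (y - c))"
    using conv_normal_density_zero_mean[of \<tau> "\<bar>w\<bar>"] assms False by (auto dest: fun_cong)
  finally show ?thesis
    using normal_density_shift[of c 0] by simp
qed

text \<open>Once the columns on which two likelihoods differ are integrated out, both carry the same
  normal factor. Halving the variance turns its square back into a multiple of a normal density, so
  the remaining columns can be treated by convolution as well.\<close>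

lemma normal_density_square:
  assumes "0 < \<tau>"
  shows "(normal_density u \<tau> y)\<^sup>2 = normal_density u (\<tau> / sqrt 2) y / (2 * sqrt pi * \<tau>)"
proof -
  have "sqrt (2 * pi * (\<tau> / sqrt 2)\<^sup>2) = sqrt pi * \<tau>"
    using assms by (simp add: power_divide real_sqrt_mult)
  moreover have "(sqrt (2 * pi * \<tau>\<^sup>2))\<^sup>2 = 2 * (sqrt pi * sqrt pi) * \<tau>\<^sup>2"
    using assms by simp
  moreover have "(exp (- (y - u)\<^sup>2 / (2 * \<tau>\<^sup>2)))\<^sup>2 = exp (- (y - u)\<^sup>2 / (2 * (\<tau> / sqrt 2)\<^sup>2))"
    using assms by (simp add: power2_eq_square mult_exp_exp field_simps)
  ultimately show ?thesis
    using assms unfolding normal_density_def power_mult_distrib power_divide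
    by (simp add: power2_eq_square field_simps)
qed

text \<open>The final integral over one response. One null density in the denominator cancels
  against the measure. The exponents then combine to
  \<open>- y\<^sup>2 / (1 + \<alpha>) + y\<^sup>2 / 2\<close>, that of a centred normal with
  variance \<open>(1 + \<alpha>) / (1 - \<alpha>)\<close>; it is integrable because
  \<open>\<alpha> < 1\<close>.\<close>

lemma nn_integral_normal_density_ratio:
  assumes "0 \<le> \<alpha>" "\<alpha> < 1"
  shows "(\<integral>\<^sup>+y. ennreal (normal_density 0 (sqrt ((1 + \<alpha>) / 2)) y / (normal_density 0 1 y)\<^sup>2) \<partial>std_normal)
    = ennreal (2 * sqrt pi / sqrt (1 - \<alpha>))"
proof -
  define v where "v = sqrt ((1 + \<alpha>) / (1 - \<alpha>))"
  have v: "0 < v" "v\<^sup>2 = (1 + \<alpha>) / (1 - \<alpha>)"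
    using assms by (auto simp: v_def)
  interpret v: prob_space "density lborel (normal_density 0 v)"
    using v by (intro prob_space_normal_density)
  have *: "normal_density 0 1 y * (normal_density 0 (sqrt ((1 + \<alpha>) / 2)) y / (normal_density 0 1 y)\<^sup>2)
      = 2 * sqrt pi / sqrt (1 - \<alpha>) * normal_density 0 v y" for y
  proof -
    have p: "normal_density 0 1 y > 0"
      by (simp add: normal_density_pos)
    have "sqrt (2 * pi * (sqrt ((1 + \<alpha>) / 2))\<^sup>2) = sqrt pi * sqrt (1 + \<alpha>)"
         "2 * (sqrt ((1 + \<alpha>) / 2))\<^sup>2 = 1 + \<alpha>"
      using assms by (simp_all add: real_sqrt_mult)
    then have f: "normal_density 0 (sqrt ((1 + \<alpha>) / 2)) y
        = 1 / (sqrt pi * sqrt (1 + \<alpha>)) * exp (- y\<^sup>2 / (1 + \<alpha>))"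
      by (simp only: normal_density_def diff_zero)
    have g: "normal_density 0 v y
        = sqrt (1 - \<alpha>) / (sqrt 2 * sqrt pi * sqrt (1 + \<alpha>)) * exp (- y\<^sup>2 * (1 - \<alpha>) / (2 * (1 + \<alpha>)))"
      using assms v by (simp add: normal_density_def real_sqrt_mult real_sqrt_divide)
    have h: "normal_density 0 1 y = exp (- y\<^sup>2 / 2) / (sqrt 2 * sqrt pi)"
      by (simp add: normal_density_def real_sqrt_mult)
    have e: "exp (- y\<^sup>2 * (1 - \<alpha>) / (2 * (1 + \<alpha>))) * exp (- y\<^sup>2 / 2) = exp (- y\<^sup>2 / (1 + \<alpha>))"
      using assms unfolding mult_exp_exp by (intro arg_cong[where f=exp]) (simp add: field_simps)
    \<comment> \<open>Bookkeeping of the normalizing constants: \<open>q\<close>, \<open>r\<close>,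
      \<open>s1\<close>, \<open>s2\<close> stand for \<open>sqrt pi\<close>, \<open>sqrt 2\<close>,
      \<open>sqrt (1 + \<alpha>)\<close>, \<open>sqrt (1 - \<alpha>)\<close>, and \<open>c\<close>,
      \<open>d\<close>, \<open>e\<close> for the exponentials.\<close>
    have alg: "1 / (q * s1) * c = 2 * q / s2 * (s2 / (r * q * s1) * d) * (e / (r * q))"
      if "d * e = c" "r * r = 2" "q > 0" "r > 0" "s1 > 0" "s2 > 0" for c d e q r s1 s2 :: real
    proof -
      have "2 * q / s2 * (s2 / (r * q * s1) * d) * (e / (r * q)) = 2 * (d * e) / (r * r * q * s1)"
        using that(3-) by (simp add: field_simps)
      then show ?thesis using that by simp
    qed
    have "normal_density 0 (sqrt ((1 + \<alpha>) / 2)) y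
       = 2 * sqrt pi / sqrt (1 - \<alpha>) * normal_density 0 v y * normal_density 0 1 y"
      unfolding f g h by (rule alg[OF e]) (use assms in auto)
    then show ?thesis
      using p by (simp add: power2_eq_square field_simps)
  qed
  have "(\<integral>\<^sup>+y. ennreal (normal_density 0 (sqrt ((1 + \<alpha>) / 2)) y / (normal_density 0 1 y)\<^sup>2) \<partial>std_normal)
     = (\<integral>\<^sup>+y. ennreal (normal_density 0 1 y) *
         ennreal (normal_density 0 (sqrt ((1 + \<alpha>) / 2)) y / (normal_density 0 1 y)\<^sup>2) \<partial>lborel)"
    unfolding std_normal_def by (subst nn_integral_density) auto
  also have "\<dots> = (\<integral>\<^sup>+y. ennreal (2 * sqrt pi / sqrt (1 - \<alpha>)) * ennreal (normal_density 0 v y) \<partial>lborel)"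
  proof (rule nn_integral_cong)
    fix y :: real
    have "0 \<le> 2 * sqrt pi / sqrt (1 - \<alpha>)"
      using assms by simp
    then show "ennreal (normal_density 0 1 y) *
         ennreal (normal_density 0 (sqrt ((1 + \<alpha>) / 2)) y / (normal_density 0 1 y)\<^sup>2)
      = ennreal (2 * sqrt pi / sqrt (1 - \<alpha>)) * ennreal (normal_density 0 v y)"
      using *[of y] by (metis ennreal_mult' normal_density_nonneg)
  qed
  also have "\<dots> = ennreal (2 * sqrt pi / sqrt (1 - \<alpha>)) * (\<integral>\<^sup>+y. ennreal (normal_density 0 v y) \<partial>lborel)"
    by (rule nn_integral_cmult) measurable
  also have "(\<integral>\<^sup>+y. ennreal (normal_density 0 v y) \<partial>lborel) = 1"
    using v.emeasure_space_1 by (simp add: emeasure_density)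
  finally show ?thesis by simp
qed

section \<open>Integrating out the columns of a Gaussian matrix\<close>

lemma nn_integral_gauss_column:
  assumes "finite I" "\<And>i. f i \<in> borel_measurable borel"
  shows "(\<integral>\<^sup>+Z. (\<Prod>i\<in>I. f i (Z (i, j))) \<partial>PiM (I \<times> {j}) (\<lambda>_. std_normal))
    = (\<Prod>i\<in>I. \<integral>\<^sup>+z. f i z \<partial>std_normal)"
proof -
  have eq: "I \<times> {j} = (\<lambda>i. (i, j)) ` I" and inj: "inj_on (\<lambda>i. (i, j)) I"
    by (auto simp: inj_on_def)
  have "(\<integral>\<^sup>+Z. (\<Prod>q\<in>I \<times> {j}. f (fst q) (Z q)) \<partial>PiM (I \<times> {j}) (\<lambda>_. std_normal))
    = (\<Prod>q\<in>I \<times> {j}. \<integral>\<^sup>+z. f (fst q) z \<partial>std_normal)"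
    using assms by (intro gauss.product_nn_integral_prod) auto
  then show ?thesis
    by (simp add: eq prod.reindex[OF inj])
qed

text \<open>In every row the weighted sum of independent standard normals adds variance
  \<open>\<Sum>j\<in>J. (w j)\<^sup>2\<close>, and distinct rows use distinct entries. Columns are
  peeled off one at a time, since the integral over a single column factors into one-dimensional
  integrals over the rows.\<close>

lemma nn_integral_gauss_matrix:
  fixes \<tau> :: real and c :: "'i \<Rightarrow> real" and w :: "'j \<Rightarrow> real"
  assumes "finite I" "finite J" "0 < \<tau>"
  shows "(\<integral>\<^sup>+X. (\<Prod>i\<in>I. ennreal (normal_density (c i + (\<Sum>j\<in>J. w j * X (i, j))) \<tau> (y i)))
       \<partial>PiM (I \<times> J) (\<lambda>_. std_normal))
    = (\<Prod>i\<in>I. ennreal (normal_density (c i) (sqrt (\<tau>\<^sup>2 + (\<Sum>j\<in>J. (w j)\<^sup>2))) (y i)))"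
  using assms(2)
proof (induction J arbitrary: c)
  case empty
  then show ?case
    using \<open>0 < \<tau>\<close> by (simp add: PiM_empty nn_integral_count_space_finite space_PiM_empty
        prob_space.emeasure_space_1[OF prob_space_gauss_PiM, simplified])
next
  case (insert k J)
  \<comment> \<open>The old columns are integrated first, with the new column frozen inside the
    mean; this is why \<open>c\<close> varies in the induction. They raise the deviation to
    \<open>\<tau>'\<close>, and column \<open>k\<close> then adds
    \<open>(w k)\<^sup>2\<close>.\<close>
  define \<tau>' where "\<tau>' = sqrt (\<tau>\<^sup>2 + (\<Sum>j\<in>J. (w j)\<^sup>2))"
  have \<tau>': "0 < \<tau>'" "\<tau>'\<^sup>2 = \<tau>\<^sup>2 + (\<Sum>j\<in>J. (w j)\<^sup>2)"
    using \<open>0 < \<tau>\<close> by (auto simp: \<tau>'_def add_pos_nonneg sum_nonneg add_nonneg_nonneg)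
  have un: "I \<times> insert k J = (I \<times> {k}) \<union> (I \<times> J)" by auto
  have dj: "(I \<times> {k}) \<inter> (I \<times> J) = {}" using insert by auto
  let ?G = "\<lambda>L. PiM L (\<lambda>_. std_normal)"
  have "(\<integral>\<^sup>+X. (\<Prod>i\<in>I. ennreal (normal_density (c i + (\<Sum>j\<in>insert k J. w j * X (i, j))) \<tau> (y i)))
       \<partial>?G (I \<times> insert k J))
    = (\<integral>\<^sup>+Z. (\<integral>\<^sup>+X. (\<Prod>i\<in>I. ennreal (normal_density (c i + (\<Sum>j\<in>insert k J. w j *
          merge (I \<times> {k}) (I \<times> J) (Z, X) (i, j))) \<tau> (y i))) \<partial>?G (I \<times> J)) \<partial>?G (I \<times> {k}))"
    unfolding un using insert.hyps assms(1) dj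
    by (intro gauss.product_nn_integral_fold) (auto, measurable)
  also have "\<dots> = (\<integral>\<^sup>+Z. (\<integral>\<^sup>+X. (\<Prod>i\<in>I. ennreal (normal_density ((c i + w k * Z (i, k)) + (\<Sum>j\<in>J. w j *
          X (i, j))) \<tau> (y i))) \<partial>?G (I \<times> J)) \<partial>?G (I \<times> {k}))"
  proof (intro nn_integral_cong prod.cong refl)
    fix Z X i assume "i \<in> I"
    have "(\<Sum>j\<in>J. w j * merge (I \<times> {k}) (I \<times> J) (Z, X) (i, j)) = (\<Sum>j\<in>J. w j * X (i, j))"
      using insert.hyps \<open>i \<in> I\<close> by (intro sum.cong) (auto simp: merge_def)
    then show "ennreal (normal_density (c i + (\<Sum>j\<in>insert k J. w j *
          merge (I \<times> {k}) (I \<times> J) (Z, X) (i, j))) \<tau> (y i))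
       = ennreal (normal_density ((c i + w k * Z (i, k)) + (\<Sum>j\<in>J. w j * X (i, j))) \<tau> (y i))"
      using insert.hyps \<open>i \<in> I\<close> by (simp add: merge_def add_ac)
  qed
  also have "\<dots> = (\<integral>\<^sup>+Z. (\<Prod>i\<in>I. ennreal (normal_density (c i + w k * Z (i, k)) \<tau>' (y i))) \<partial>?G (I \<times> {k}))"
    by (simp add: insert.IH \<tau>'_def)
  also have "\<dots> = (\<Prod>i\<in>I. \<integral>\<^sup>+z. ennreal (normal_density (c i + w k * z) \<tau>' (y i)) \<partial>std_normal)"
    using assms(1) by (intro nn_integral_gauss_column) auto
  also have "\<dots> = (\<Prod>i\<in>I. ennreal (normal_density (c i) (sqrt (\<tau>'\<^sup>2 + (w k)\<^sup>2)) (y i)))"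
    using \<tau>' by (simp add: nn_integral_normal_density_std_normal)
  finally show ?case
    using insert.hyps by (simp add: \<tau>' add_ac)
qed

section \<open>The law of the data as a density\<close>

lemma distr_std_normal_affine:
  assumes "0 < \<sigma>"
  shows "distr std_normal borel (\<lambda>z. u + \<sigma> * z) = density lborel (\<lambda>y. ennreal (normal_density u \<sigma> y))"
proof -
  have "distributed std_normal lborel (\<lambda>x. x) (\<lambda>x. ennreal (normal_density 0 1 x))"
    unfolding distributed_def by (auto simp: std_normal_def distr_id2)
  from std_normal.normal_density_affine[OF this, of \<sigma> u] assms
  have "distr std_normal lborel (\<lambda>z. u + \<sigma> * z) = density lborel (\<lambda>y. ennreal (normal_density u \<sigma> y))"
    by (simp add: distributed_def)
  moreover have "distr std_normal lborel (\<lambda>z. u + \<sigma> * z) = distr std_normal borel (\<lambda>z. u + \<sigma> * z)"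
    by (intro distr_cong) auto
  ultimately show ?thesis by simp
qed

lemma density_std_normal_ratio:
  "density std_normal (\<lambda>y. ennreal (normal_density u \<sigma> y / normal_density 0 1 y))
    = density lborel (\<lambda>y. ennreal (normal_density u \<sigma> y))"
  unfolding std_normal_def
  by (subst density_density_eq)
     (auto intro!: density_cong simp: ennreal_mult'[symmetric] normal_density_pos less_imp_neq[symmetric])

text \<open>Both sides are identified with the product of the laws N(\<open>u i\<close>,
  \<open>\<sigma>\<^sup>2\<close>) by evaluating them on boxes, where everything factors over the
  coordinates. In the model, \<open>u\<close> is the vector of row means for a fixed design.\<close>

lemma distr_gauss_affine:
  fixes I :: "'i set"
  assumes "finite I" "0 < \<sigma>"
  shows "distr (PiM I (\<lambda>_. std_normal)) (PiM I (\<lambda>_. borel)) (\<lambda>\<xi>. \<lambda>i\<in>I. u i + \<sigma> * \<xi> i)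
    = density (PiM I (\<lambda>_. std_normal)) (\<lambda>y. ennreal (\<Prod>i\<in>I. normal_density (u i) \<sigma> (y i) / normal_density 0 1 (y i)))"
    (is "?D = ?E")
proof -
  let ?M = "\<lambda>i. density lborel (\<lambda>y. ennreal (normal_density (u i) \<sigma> y))"
  interpret product_sigma_finite ?M
    using assms by (intro product_sigma_finite.intro prob_space_imp_sigma_finite prob_space_normal_density)
  have sets_M: "sets (PiM I ?M) = sets (PiM I (\<lambda>_. borel))" "sets (PiM I (\<lambda>_. std_normal)) = sets (PiM I (\<lambda>_. borel))"
    by (auto intro!: sets_PiM_cong)
  have "?D = PiM I ?M"
  proof (rule PiM_eqI)
    fix A :: "'i \<Rightarrow> real set" assume "\<And>i. i \<in> I \<Longrightarrow> A i \<in> sets (?M i)"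
    then have A[measurable]: "\<And>i. i \<in> I \<Longrightarrow> A i \<in> sets borel" by simp
    have "emeasure ?D (Pi\<^sub>E I A) = emeasure (PiM I (\<lambda>_. std_normal)) (Pi\<^sub>E I (\<lambda>i. (\<lambda>z. u i + \<sigma> * z) -` A i))"
    proof (subst emeasure_distr)
      show "Pi\<^sub>E I A \<in> sets (PiM I (\<lambda>_. borel))"
        using assms A by (intro sets_PiM_I_finite) auto
      show "(\<lambda>\<xi>. \<lambda>i\<in>I. u i + \<sigma> * \<xi> i) \<in> measurable (PiM I (\<lambda>_. std_normal)) (PiM I (\<lambda>_. borel))"
        by measurable
    qed (intro arg_cong2[where f=emeasure], auto simp: space_PiM PiE_iff)
    also have "\<dots> = (\<Prod>i\<in>I. emeasure std_normal ((\<lambda>z. u i + \<sigma> * z) -` A i))"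
      by (rule gauss.emeasure_PiM)
         (use assms A in \<open>auto intro!: measurable_sets[of "\<lambda>z. u _ + \<sigma> * z" borel borel, simplified]\<close>)
    also have "\<dots> = (\<Prod>i\<in>I. emeasure (?M i) (A i))"
      using A by (intro prod.cong refl) (simp add: distr_std_normal_affine[OF assms(2), symmetric] emeasure_distr)
    finally show "emeasure ?D (Pi\<^sub>E I A) = (\<Prod>i\<in>I. emeasure (?M i) (A i))" .
  qed (use assms sets_M in auto)
  moreover have "?E = PiM I ?M"
  proof (rule PiM_eqI)
    fix A :: "'i \<Rightarrow> real set" assume "\<And>i. i \<in> I \<Longrightarrow> A i \<in> sets (?M i)"
    then have A[measurable]: "\<And>i. i \<in> I \<Longrightarrow> A i \<in> sets borel" by simp
    let ?f = "\<lambda>i y. ennreal (normal_density (u i) \<sigma> y / normal_density 0 1 y)"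
    have "emeasure ?E (Pi\<^sub>E I A) = (\<integral>\<^sup>+y. ennreal (\<Prod>i\<in>I. normal_density (u i) \<sigma> (y i) / normal_density 0 1 (y i))
        * indicator (Pi\<^sub>E I A) y \<partial>PiM I (\<lambda>_. std_normal))"
      using assms A by (intro emeasure_density sets_PiM_I_finite) auto
    also have "\<dots> = (\<integral>\<^sup>+y. (\<Prod>i\<in>I. ?f i (y i) * indicator (A i) (y i)) \<partial>PiM I (\<lambda>_. std_normal))"
    proof (rule nn_integral_cong)
      fix y assume "y \<in> space (PiM I (\<lambda>_. std_normal))"
      then have "indicator (Pi\<^sub>E I A) y = (\<Prod>i\<in>I. indicator (A i) (y i) :: ennreal)"
        using assms(1) by (auto simp: indicator_def space_PiM PiE_iff prod_zero)
      then show "ennreal (\<Prod>i\<in>I. normal_density (u i) \<sigma> (y i) / normal_density 0 1 (y i)) * indicator (Pi\<^sub>E I A) y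
          = (\<Prod>i\<in>I. ?f i (y i) * indicator (A i) (y i))"
        by (simp add: prod.distrib prod_ennreal)
    qed
    also have "\<dots> = (\<Prod>i\<in>I. \<integral>\<^sup>+y. ?f i y * indicator (A i) y \<partial>std_normal)"
      by (rule gauss.product_nn_integral_prod) (use assms in auto)
    also have "\<dots> = (\<Prod>i\<in>I. emeasure (?M i) (A i))"
      using A by (intro prod.cong refl) (simp add: density_std_normal_ratio[symmetric] emeasure_density)
    finally show "emeasure ?E (Pi\<^sub>E I A) = (\<Prod>i\<in>I. emeasure (?M i) (A i))" .
  qed (use assms sets_M in auto)
  ultimately show ?thesis by simp
qed

text \<open>The reference measure is \<open>design_noise\<close>, which is also the null law with
  unit noise. The design has the same law under all parameters, so only the densities of the
  responses given the design remain.\<close>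

definition lik_ratio :: "nat \<Rightarrow> nat \<Rightarrow> (nat \<Rightarrow> real) \<Rightarrow> real \<Rightarrow> (nat \<times> nat \<Rightarrow> real) \<times> (nat \<Rightarrow> real) \<Rightarrow> real" where
  "lik_ratio N p \<theta> \<sigma> = (\<lambda>(X, y). \<Prod>i<N. normal_density (\<Sum>j<p. X (i, j) * \<theta> j) \<sigma> (y i) / normal_density 0 1 (y i))"

lemma lik_ratio_nonneg: "0 \<le> lik_ratio N p \<theta> \<sigma> z"
  by (auto simp: lik_ratio_def split: prod.split intro!: prod_nonneg)

lemma sets_design_noise [simp, measurable_cong]: "sets (design_noise N p) = sets (obs_space N p)"
  unfolding design_noise_def obs_space_def by (intro sets_pair_measure_cong sets_PiM_cong) auto

lemma space_design_noise [simp]: "space (design_noise N p) = space (obs_space N p)"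
  by (rule sets_eq_imp_space_eq) simp

lemma prob_space_design_noise: "prob_space (design_noise N p)"
  unfolding design_noise_def by (intro prob_space_pair prob_space_gauss_PiM)

lemma borel_measurable_lik_ratio [measurable]: "lik_ratio N p \<theta> \<sigma> \<in> borel_measurable (obs_space N p)"
  unfolding lik_ratio_def obs_space_def by measurable

lemma sets_model_law [simp, measurable_cong]: "sets (model_law N p \<theta> \<sigma>) = sets (obs_space N p)"
  by (simp add: model_law_def)

lemma space_model_law [simp]: "space (model_law N p \<theta> \<sigma>) = space (obs_space N p)"
  by (simp add: model_law_def)

text \<open>Given the design, the response is an affine image of the noise. By Fubini it suffices to
  apply \<open>distr_gauss_affine\<close> to the section of the event at each fixed
  \<open>X\<close>.\<close>

lemma model_law_eq_density:
  assumes "0 < \<sigma>"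
  shows "model_law N p \<theta> \<sigma> = density (design_noise N p) (\<lambda>z. ennreal (lik_ratio N p \<theta> \<sigma> z))"
proof (rule measure_eqI)
  fix A assume "A \<in> sets (model_law N p \<theta> \<sigma>)"
  then have A: "A \<in> sets (obs_space N p)" by simp
  let ?PX = "PiM ({..<N} \<times> {..<p}) (\<lambda>_. std_normal)" and ?PY = "PiM {..<N} (\<lambda>_. std_normal)"
  interpret PX: prob_space ?PX by (rule prob_space_gauss_PiM)
  interpret PY: prob_space ?PY by (rule prob_space_gauss_PiM)
  note A[unfolded obs_space_def, measurable]
  have sX: "sets ?PX = sets (PiM ({..<N} \<times> {..<p}) (\<lambda>_. borel))" "sets ?PY = sets (PiM {..<N} (\<lambda>_. borel))"
    by (auto intro!: sets_PiM_cong)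
  note [measurable_cong] = sX
  have [simp]: "(\<lambda>z. (fst z, response N p \<theta> \<sigma> (fst z) (snd z))) \<in> measurable (design_noise N p) (obs_space N p)"
    unfolding design_noise_def obs_space_def response_def by measurable
  have "emeasure (model_law N p \<theta> \<sigma>) A
      = (\<integral>\<^sup>+z. indicator A z \<partial>model_law N p \<theta> \<sigma>)"
    using A by simp
  also have "\<dots> = (\<integral>\<^sup>+z. indicator A (fst z, response N p \<theta> \<sigma> (fst z) (snd z)) \<partial>design_noise N p)"
    unfolding model_law_def using A by (subst nn_integral_distr) (auto simp: case_prod_unfold)
  also have "\<dots> = (\<integral>\<^sup>+X. (\<integral>\<^sup>+\<xi>. indicator A (X, response N p \<theta> \<sigma> X \<xi>) \<partial>?PY) \<partial>?PX)"
    unfolding design_noise_def response_def by (subst PY.nn_integral_fst[symmetric]) (auto, measurable)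
  also have "\<dots> = (\<integral>\<^sup>+X. (\<integral>\<^sup>+y. ennreal (lik_ratio N p \<theta> \<sigma> (X, y)) * indicator A (X, y) \<partial>?PY) \<partial>?PX)"
  proof (rule nn_integral_cong)
    fix X assume [measurable]: "X \<in> space ?PX"
    then have [simp]: "X \<in> space (PiM ({..<N} \<times> {..<p}) (\<lambda>_. borel))"
      by (simp add: space_PiM)
    let ?u = "\<lambda>i. \<Sum>j<p. X (i, j) * \<theta> j"
    have [measurable]: "Pair X -` A \<in> sets (PiM {..<N} (\<lambda>_. borel))"
      using A unfolding obs_space_def by (rule sets_Pair1)
    have ind: "indicator A (X, y) = (indicator (Pair X -` A) y :: ennreal)" for y
      by (auto simp: indicator_def)
    have "(\<integral>\<^sup>+\<xi>. indicator A (X, response N p \<theta> \<sigma> X \<xi>) \<partial>?PY)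
       = (\<integral>\<^sup>+y. indicator (Pair X -` A) y \<partial>distr ?PY (PiM {..<N} (\<lambda>_. borel)) (\<lambda>\<xi>. \<lambda>i\<in>{..<N}. ?u i + \<sigma> * \<xi> i))"
      unfolding response_def ind by (subst nn_integral_distr) auto
    also have "\<dots> = (\<integral>\<^sup>+y. ennreal (lik_ratio N p \<theta> \<sigma> (X, y)) * indicator A (X, y) \<partial>?PY)"
      unfolding distr_gauss_affine[OF finite_lessThan assms]
      by (subst nn_integral_density) (auto simp: lik_ratio_def ind)
    finally show "(\<integral>\<^sup>+\<xi>. indicator A (X, response N p \<theta> \<sigma> X \<xi>) \<partial>?PY)
      = (\<integral>\<^sup>+y. ennreal (lik_ratio N p \<theta> \<sigma> (X, y)) * indicator A (X, y) \<partial>?PY)" .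
  qed
  also have "\<dots> = (\<integral>\<^sup>+z. ennreal (lik_ratio N p \<theta> \<sigma> z) * indicator A z \<partial>design_noise N p)"
    unfolding design_noise_def using borel_measurable_lik_ratio[of N p \<theta> \<sigma>, unfolded obs_space_def]
    by (subst PY.nn_integral_fst[symmetric]) (auto, measurable)
  also have "\<dots> = emeasure (density (design_noise N p) (\<lambda>z. ennreal (lik_ratio N p \<theta> \<sigma> z))) A"
    using A by (subst emeasure_density) auto
  finally show "emeasure (model_law N p \<theta> \<sigma>) A = \<dots>" .
qed simp

lemma model_law_null: "model_law N p (zero_vec p) 1 = design_noise N p"
proof -
  have "normal_density 0 1 y / normal_density 0 1 y = 1" for y :: real
    using normal_density_pos[of 1 0 y] by simp
  then have "lik_ratio N p (zero_vec p) 1 = (\<lambda>_. 1)"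
    by (auto simp: lik_ratio_def zero_vec_def fun_eq_iff)
  then show ?thesis
    by (simp add: model_law_eq_density density_1)
qed

section \<open>Mixed second moments of likelihood ratios\<close>

text \<open>The columns in \<open>J'\<close> are seen by the second factor only. The first factor is
  constant in them and leaves the inner integral, while in the second they turn into extra variance.
  This is applied once to each of the two private parts of a pair of supports.\<close>

lemma nn_integral_gauss_matrix_marginal:
  fixes a \<tau> \<tau>' :: real
  assumes "finite I" "finite J" "finite J'" "J \<inter> J' = {}" "S \<subseteq> J" "K \<subseteq> J" "0 < \<tau>"
  shows "(\<integral>\<^sup>+X. (\<Prod>i\<in>I. ennreal (normal_density (\<Sum>j\<in>S. a * X (i, j)) \<tau>' (y i))) *
        (\<Prod>i\<in>I. ennreal (normal_density ((\<Sum>j\<in>K. a * X (i, j)) + (\<Sum>j\<in>J'. a * X (i, j))) \<tau> (y i)))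
       \<partial>PiM (I \<times> (J \<union> J')) (\<lambda>_. std_normal))
    = (\<integral>\<^sup>+X. (\<Prod>i\<in>I. ennreal (normal_density (\<Sum>j\<in>S. a * X (i, j)) \<tau>' (y i))) *
        (\<Prod>i\<in>I. ennreal (normal_density (\<Sum>j\<in>K. a * X (i, j)) (sqrt (\<tau>\<^sup>2 + card J' * a\<^sup>2)) (y i)))
       \<partial>PiM (I \<times> J) (\<lambda>_. std_normal))"
proof -
  let ?G = "\<lambda>L. PiM L (\<lambda>_. std_normal)"
  let ?m = "\<lambda>X Z. merge (I \<times> J) (I \<times> J') (X, Z)"
  have un: "I \<times> (J \<union> J') = (I \<times> J) \<union> (I \<times> J')" by auto
  have dj: "(I \<times> J) \<inter> (I \<times> J') = {}" using assms by auto
  have meas1[measurable]: "(\<lambda>X. \<Sum>j\<in>L. a * X (i, j)) \<in> borel_measurable (?G (I \<times> L'))"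
    if "i \<in> I" "L \<subseteq> L'" for i L L'
    using that by (intro borel_measurable_sum borel_measurable_times measurable_const) auto
  have "(\<integral>\<^sup>+X. (\<Prod>i\<in>I. ennreal (normal_density (\<Sum>j\<in>S. a * X (i, j)) \<tau>' (y i))) *
        (\<Prod>i\<in>I. ennreal (normal_density ((\<Sum>j\<in>K. a * X (i, j)) + (\<Sum>j\<in>J'. a * X (i, j))) \<tau> (y i)))
       \<partial>?G (I \<times> (J \<union> J')))
    = (\<integral>\<^sup>+X. (\<integral>\<^sup>+Z. (\<Prod>i\<in>I. ennreal (normal_density (\<Sum>j\<in>S. a * ?m X Z (i, j)) \<tau>' (y i))) *
        (\<Prod>i\<in>I. ennreal (normal_density ((\<Sum>j\<in>K. a * ?m X Z (i, j)) + (\<Sum>j\<in>J'. a * ?m X Z (i, j))) \<tau> (y i)))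
       \<partial>?G (I \<times> J')) \<partial>?G (I \<times> J))"
    unfolding un using assms dj
    by (intro gauss.product_nn_integral_fold)
       (auto simp flip: un intro!: borel_measurable_times_ennreal borel_measurable_prod_ennreal
          measurable_compose[OF _ measurable_ennreal] borel_measurable_normal_density' borel_measurable_add meas1)
  also have "\<dots> = (\<integral>\<^sup>+X. (\<integral>\<^sup>+Z. (\<Prod>i\<in>I. ennreal (normal_density (\<Sum>j\<in>S. a * X (i, j)) \<tau>' (y i))) *
        (\<Prod>i\<in>I. ennreal (normal_density ((\<Sum>j\<in>K. a * X (i, j)) + (\<Sum>j\<in>J'. a * Z (i, j))) \<tau> (y i)))
       \<partial>?G (I \<times> J')) \<partial>?G (I \<times> J))"
  proof (intro nn_integral_cong, rule arg_cong2[where f="(*)"]; rule prod.cong[OF refl])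
    fix X Z i assume i: "i \<in> I"
    have J: "(\<Sum>j\<in>L. a * ?m X Z (i, j)) = (\<Sum>j\<in>L. a * X (i, j))" if "L \<subseteq> J" for L
      using that i by (intro sum.cong) (auto simp: merge_def)
    have J': "(\<Sum>j\<in>J'. a * ?m X Z (i, j)) = (\<Sum>j\<in>J'. a * Z (i, j))"
      using i assms(4) by (intro sum.cong) (auto simp: merge_def)
    show "ennreal (normal_density (\<Sum>j\<in>S. a * ?m X Z (i, j)) \<tau>' (y i))
        = ennreal (normal_density (\<Sum>j\<in>S. a * X (i, j)) \<tau>' (y i))"
      by (simp only: J[OF assms(5)])
    show "ennreal (normal_density ((\<Sum>j\<in>K. a * ?m X Z (i, j)) + (\<Sum>j\<in>J'. a * ?m X Z (i, j))) \<tau> (y i))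
       = ennreal (normal_density ((\<Sum>j\<in>K. a * X (i, j)) + (\<Sum>j\<in>J'. a * Z (i, j))) \<tau> (y i))"
      by (simp only: J[OF assms(6)] J')
  qed
  also have "\<dots> = (\<integral>\<^sup>+X. (\<Prod>i\<in>I. ennreal (normal_density (\<Sum>j\<in>S. a * X (i, j)) \<tau>' (y i))) *
        (\<integral>\<^sup>+Z. (\<Prod>i\<in>I. ennreal (normal_density ((\<Sum>j\<in>K. a * X (i, j)) + (\<Sum>j\<in>J'. a * Z (i, j))) \<tau> (y i)))
       \<partial>?G (I \<times> J')) \<partial>?G (I \<times> J))"
    by (intro nn_integral_cong nn_integral_cmult)
       (auto intro!: borel_measurable_prod_ennreal
          measurable_compose[OF _ measurable_ennreal] borel_measurable_normal_density' borel_measurable_add meas1)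
  finally show ?thesis
    using assms by (simp add: nn_integral_gauss_matrix)
qed

text \<open>The columns of \<open>T\<close> outside \<open>S\<close> are integrated out first, then
  those of \<open>S\<close> outside \<open>T\<close>. What is left are two equal factors in the
  shared columns. Their product is a multiple of a normal density with variance
  \<open>(1 - \<alpha>) / 2\<close>, to which the shared columns add
  \<open>\<alpha>\<close>.\<close>

lemma nn_integral_gauss_matrix_overlap:
  fixes a \<sigma> :: real and I :: "'i set" and P :: "'j set"
  assumes I: "finite I" and P: "finite P" "S \<subseteq> P" "T \<subseteq> P" and card: "card S = card T"
    and \<sigma>: "0 < \<sigma>" "card S * a\<^sup>2 + \<sigma>\<^sup>2 = 1"
  defines "\<alpha> \<equiv> card (S \<inter> T) * a\<^sup>2"
  shows "(\<integral>\<^sup>+X. (\<Prod>i\<in>I. ennreal (normal_density (\<Sum>j\<in>S. a * X (i, j)) \<sigma> (y i))) *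
        (\<Prod>i\<in>I. ennreal (normal_density (\<Sum>j\<in>T. a * X (i, j)) \<sigma> (y i)))
       \<partial>PiM (I \<times> P) (\<lambda>_. std_normal))
    = (\<Prod>i\<in>I. ennreal (normal_density 0 (sqrt ((1 + \<alpha>) / 2)) (y i) / (2 * sqrt pi * sqrt (1 - \<alpha>))))"
proof -
  let ?G = "\<lambda>L. PiM L (\<lambda>_. std_normal)"
  let ?F = "\<lambda>L \<tau> X. \<Prod>i\<in>I. ennreal (normal_density (\<Sum>j\<in>L. a * X (i, j)) \<tau> (y i))"
  define K where "K = S \<inter> T"
  \<comment> \<open>\<open>R\<close> holds the shared columns as well as those outside both
    supports.\<close>
  define R where "R = P - (S - K) - (T - K)"
  have fin: "finite S" "finite T" "finite K" "finite R"
    using P by (auto simp: K_def R_def intro: finite_subset)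
  have cd: "card (S - K) + card K = card S" "card (T - K) + card K = card T"
    using fin card_mono[of S K] card_mono[of T K] by (simp_all add: K_def card_Diff_subset)
  have "real (card (S - K)) = card S - real (card K)" "real (card (T - K)) = card S - real (card K)"
    using cd card by linarith+
  \<comment> \<open>Since \<open>card S * a\<^sup>2 + \<sigma>\<^sup>2 = 1\<close>, either private
    part lifts the noise variance to \<open>1 - \<alpha>\<close>, the variance of a response given
    the shared columns.\<close>
  then have var: "\<sigma>\<^sup>2 + card (S - K) * a\<^sup>2 = 1 - \<alpha>" "\<sigma>\<^sup>2 + card (T - K) * a\<^sup>2 = 1 - \<alpha>"
    using \<sigma>(2) by (simp_all add: \<alpha>_def K_def[symmetric] left_diff_distrib)
  have \<alpha>: "0 \<le> \<alpha>" "\<alpha> < 1"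
  proof -
    show "0 \<le> \<alpha>" by (simp add: \<alpha>_def)
    have "0 < \<sigma>\<^sup>2 + card (S - K) * a\<^sup>2" using \<sigma> by (intro add_pos_nonneg) auto
    then show "\<alpha> < 1" using var by simp
  qed
  have split: "(\<Sum>j\<in>L. a * X (i, j)) = (\<Sum>j\<in>K. a * X (i, j)) + (\<Sum>j\<in>L - K. a * X (i, j))"
    if "K \<subseteq> L" "finite L" for L X and i :: 'i
    by (subst sum.subset_diff[OF that]) (rule add.commute)
  have K: "K \<subseteq> S" "K \<subseteq> T" "K \<subseteq> R" and P1: "(R \<union> (S - K)) \<union> (T - K) = P"
    and sub: "S \<subseteq> R \<union> (S - K)" "K \<subseteq> R \<union> (S - K)"
    and disj: "(R \<union> (S - K)) \<inter> (T - K) = {}" "R \<inter> (S - K) = {}"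
    and fin': "finite (R \<union> (S - K))" "finite (S - K)" "finite (T - K)"
    using P fin by (auto simp: K_def R_def)
  have "(\<integral>\<^sup>+X. ?F S \<sigma> X * ?F T \<sigma> X \<partial>?G (I \<times> P))
     = (\<integral>\<^sup>+X. ?F S \<sigma> X * ?F K (sqrt (1 - \<alpha>)) X \<partial>?G (I \<times> (R \<union> (S - K))))"
    using nn_integral_gauss_matrix_marginal[OF I fin'(1) fin'(3) disj(1) sub \<sigma>(1), of a \<sigma> y]
    unfolding P1 var split[OF K(2) fin(2), symmetric] .
  also have "\<dots> = (\<integral>\<^sup>+X. ?F K (sqrt (1 - \<alpha>)) X * ?F S \<sigma> X \<partial>?G (I \<times> (R \<union> (S - K))))"
    by (simp only: mult.commute)
  also have "\<dots> = (\<integral>\<^sup>+X. ?F K (sqrt (1 - \<alpha>)) X * ?F K (sqrt (1 - \<alpha>)) X \<partial>?G (I \<times> R))"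
    using nn_integral_gauss_matrix_marginal[OF I fin(4) fin'(2) disj(2) K(3) K(3) \<sigma>(1), of a "sqrt (1 - \<alpha>)" y]
    unfolding var split[OF K(1) fin(1), symmetric] .
  \<comment> \<open>The two factors now agree, so \<open>normal_density_square\<close> applies.
    Columns of \<open>R\<close> outside \<open>K\<close> receive weight zero, which makes the sum
    range over the whole remaining matrix.\<close>
  also have "\<dots> = (\<integral>\<^sup>+X. (\<Prod>i\<in>I. ennreal (1 / (2 * sqrt pi * sqrt (1 - \<alpha>)))) *
      (\<Prod>i\<in>I. ennreal (normal_density (0 + (\<Sum>j\<in>R. (if j \<in> K then a else 0) * X (i, j))) (sqrt (1 - \<alpha>) / sqrt 2) (y i))) \<partial>?G (I \<times> R))"
  proof (intro nn_integral_cong)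
    fix X
    have eq: "(\<Sum>j\<in>R. (if j \<in> K then a else 0) * X (i, j)) = (\<Sum>j\<in>K. a * X (i, j))" for i :: 'i
      using fin(4) K(3) by (intro sum.mono_neutral_cong_right) auto
    have "ennreal (normal_density v (sqrt (1 - \<alpha>)) x) * ennreal (normal_density v (sqrt (1 - \<alpha>)) x)
       = ennreal (1 / (2 * sqrt pi * sqrt (1 - \<alpha>))) * ennreal (normal_density (0 + v) (sqrt (1 - \<alpha>) / sqrt 2) x)" for v x
      using \<alpha> normal_density_square[of "sqrt (1 - \<alpha>)" v x]
      by (simp add: ennreal_mult'[symmetric] power2_eq_square)
    then show "?F K (sqrt (1 - \<alpha>)) X * ?F K (sqrt (1 - \<alpha>)) X
       = (\<Prod>i\<in>I. ennreal (1 / (2 * sqrt pi * sqrt (1 - \<alpha>)))) *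
      (\<Prod>i\<in>I. ennreal (normal_density (0 + (\<Sum>j\<in>R. (if j \<in> K then a else 0) * X (i, j))) (sqrt (1 - \<alpha>) / sqrt 2) (y i)))"
      unfolding eq prod.distrib[symmetric] by (intro prod.cong refl)
  qed
  also have "\<dots> = (\<Prod>i\<in>I. ennreal (1 / (2 * sqrt pi * sqrt (1 - \<alpha>)))) *
      (\<integral>\<^sup>+X. (\<Prod>i\<in>I. ennreal (normal_density (0 + (\<Sum>j\<in>R. (if j \<in> K then a else 0) * X (i, j))) (sqrt (1 - \<alpha>) / sqrt 2) (y i))) \<partial>?G (I \<times> R))"
    by (intro nn_integral_cmult borel_measurable_prod_ennreal measurable_compose[OF _ measurable_ennreal]
          borel_measurable_normal_density' borel_measurable_add borel_measurable_sum borel_measurable_times) auto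
  also have "(\<integral>\<^sup>+X. (\<Prod>i\<in>I. ennreal (normal_density (0 + (\<Sum>j\<in>R. (if j \<in> K then a else 0) * X (i, j))) (sqrt (1 - \<alpha>) / sqrt 2) (y i))) \<partial>?G (I \<times> R))
     = (\<Prod>i\<in>I. ennreal (normal_density 0 (sqrt ((sqrt (1 - \<alpha>) / sqrt 2)\<^sup>2 + (\<Sum>j\<in>R. (if j \<in> K then a else 0)\<^sup>2))) (y i)))"
    by (rule nn_integral_gauss_matrix) (use I fin \<alpha> in auto)
  also have "(\<Sum>j\<in>R. (if j \<in> K then a else 0)\<^sup>2) = (\<Sum>j\<in>K. a\<^sup>2)"
    using fin(4) K(3) by (intro sum.mono_neutral_cong_right) auto
  also have "\<dots> = \<alpha>" by (simp add: \<alpha>_def K_def)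
  also have "(sqrt (1 - \<alpha>) / sqrt 2)\<^sup>2 + \<alpha> = (1 + \<alpha>) / 2"
  proof -
    have "(sqrt (1 - \<alpha>) / sqrt 2)\<^sup>2 = (1 - \<alpha>) / 2"
      using \<alpha> by (simp add: power_divide)
    then show ?thesis by argo
  qed
  also have "(\<Prod>i\<in>I. ennreal (1 / (2 * sqrt pi * sqrt (1 - \<alpha>)))) *
      (\<Prod>i\<in>I. ennreal (normal_density 0 (sqrt ((1 + \<alpha>) / 2)) (y i)))
    = (\<Prod>i\<in>I. ennreal (normal_density 0 (sqrt ((1 + \<alpha>) / 2)) (y i) / (2 * sqrt pi * sqrt (1 - \<alpha>))))"
  proof -
    have "ennreal (1 / c) * ennreal x = ennreal (x / c)" if "0 < c" for c x :: real
      using that by (simp flip: ennreal_mult')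
    then show ?thesis
      unfolding prod.distrib[symmetric] by (intro prod.cong refl) (use \<alpha> in simp)
  qed
  finally show ?thesis .
qed

definition flat_vec :: "nat \<Rightarrow> nat set \<Rightarrow> real \<Rightarrow> nat \<Rightarrow> real" where
  "flat_vec p S a = (\<lambda>j\<in>{..<p}. if j \<in> S then a else 0)"

lemma sum_times_flat_vec:
  assumes "S \<subseteq> {..<p}"
  shows "(\<Sum>j<p. X j * flat_vec p S a j) = (\<Sum>j\<in>S. a * X j)"
  using assms by (intro sum.mono_neutral_cong_right) (auto simp: flat_vec_def)

text \<open>The response is held fixed while the design is integrated out, which leaves a product
  over the rows. Each row contributes \<open>1 / (2 * sqrt pi * sqrt (1 - \<alpha>))\<close> times
  \<open>2 * sqrt pi / sqrt (1 - \<alpha>)\<close>, that is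
  \<open>1 / (1 - \<alpha>)\<close>.\<close>

lemma nn_integral_lik_ratio_product:
  fixes a \<sigma> :: real
  assumes P: "S \<subseteq> {..<p}" "T \<subseteq> {..<p}" and card: "card S = card T"
    and \<sigma>: "0 < \<sigma>" "card S * a\<^sup>2 + \<sigma>\<^sup>2 = 1"
  shows "(\<integral>\<^sup>+z. ennreal (lik_ratio N p (flat_vec p S a) \<sigma> z * lik_ratio N p (flat_vec p T a) \<sigma> z) \<partial>design_noise N p)
    = ennreal ((1 / (1 - card (S \<inter> T) * a\<^sup>2)) ^ N)"
proof -
  define \<alpha> where "\<alpha> = card (S \<inter> T) * a\<^sup>2"
  have "card (S \<inter> T) \<le> card S"
    using P by (intro card_mono finite_subset[OF P(1)]) auto
  then have "\<alpha> \<le> card S * a\<^sup>2" unfolding \<alpha>_def by (intro mult_right_mono) auto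
  moreover have "0 < \<sigma>\<^sup>2" using \<sigma> by simp
  ultimately have \<alpha>: "0 \<le> \<alpha>" "\<alpha> < 1"
    using \<sigma> by (simp add: \<alpha>_def, linarith)
  let ?PX = "PiM ({..<N} \<times> {..<p}) (\<lambda>_. std_normal)" and ?PY = "PiM {..<N} (\<lambda>_. std_normal)"
  interpret PX: prob_space ?PX by (rule prob_space_gauss_PiM)
  interpret PY: prob_space ?PY by (rule prob_space_gauss_PiM)
  interpret PP: pair_prob_space ?PX ?PY ..
  let ?L = "\<lambda>S. lik_ratio N p (flat_vec p S a) \<sigma>"
  let ?F = "\<lambda>S X y. \<Prod>i<N. ennreal (normal_density (\<Sum>j\<in>S. a * X (i, j)) \<sigma> (y i))"
  have [measurable]: "?L S' \<in> borel_measurable (?PX \<Otimes>\<^sub>M ?PY)" for S'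
    unfolding measurable_cong_sets[OF sets_design_noise[unfolded design_noise_def] refl]
    by (rule borel_measurable_lik_ratio)
  have meas1: "(\<lambda>X. \<Sum>j\<in>L. a * X (i, j)) \<in> borel_measurable ?PX"
    if "i < N" "L \<subseteq> {..<p}" for i L
    using that by (intro borel_measurable_sum borel_measurable_times measurable_const) auto
  \<comment> \<open>The null densities in the two denominators depend on \<open>y\<close> alone and
    leave the integral over the design.\<close>
  let ?c = "\<lambda>y. \<Prod>i<N. ennreal (1 / (normal_density 0 1 (y i))\<^sup>2)"
  have prod: "ennreal (?L S (X, y) * ?L T (X, y)) = ?c y * (?F S X y * ?F T X y)" for X y
    unfolding lik_ratio_def prod.case sum_times_flat_vec[OF P(1)] sum_times_flat_vec[OF P(2)] prod.distrib[symmetric]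
    by (subst prod_ennreal[symmetric])
       (auto intro!: prod.cong simp: ennreal_mult'[symmetric] power2_eq_square)
  have "(\<integral>\<^sup>+z. ennreal (?L S z * ?L T z) \<partial>design_noise N p)
     = (\<integral>\<^sup>+y. (\<integral>\<^sup>+X. ennreal (?L S (X, y) * ?L T (X, y)) \<partial>?PX) \<partial>?PY)"
    unfolding design_noise_def by (rule PP.nn_integral_snd[symmetric]) measurable
  also have "\<dots> = (\<integral>\<^sup>+y. ?c y * (\<integral>\<^sup>+X. ?F S X y * ?F T X y \<partial>?PX) \<partial>?PY)"
    unfolding prod using P
    by (intro nn_integral_cong nn_integral_cmult borel_measurable_times_ennreal borel_measurable_prod_ennreal
          measurable_compose[OF _ measurable_ennreal] borel_measurable_normal_density') (auto intro!: meas1)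
  also have "\<dots> = (\<integral>\<^sup>+y. (\<Prod>i<N. ennreal (1 / (2 * sqrt pi * sqrt (1 - \<alpha>))) *
        ennreal (normal_density 0 (sqrt ((1 + \<alpha>) / 2)) (y i) / (normal_density 0 1 (y i))\<^sup>2)) \<partial>?PY)"
  proof (rule nn_integral_cong)
    fix y
    have "(\<integral>\<^sup>+X. ?F S X y * ?F T X y \<partial>?PX)
      = (\<Prod>i<N. ennreal (normal_density 0 (sqrt ((1 + \<alpha>) / 2)) (y i) / (2 * sqrt pi * sqrt (1 - \<alpha>))))"
      unfolding \<alpha>_def by (rule nn_integral_gauss_matrix_overlap) (use assms in auto)
    then show "?c y * (\<integral>\<^sup>+X. ?F S X y * ?F T X y \<partial>?PX) = (\<Prod>i<N. ennreal (1 / (2 * sqrt pi * sqrt (1 - \<alpha>))) *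
        ennreal (normal_density 0 (sqrt ((1 + \<alpha>) / 2)) (y i) / (normal_density 0 1 (y i))\<^sup>2))"
      using \<alpha> by (simp only: prod.distrib[symmetric]) (intro prod.cong refl, simp add: ennreal_mult'[symmetric])
  qed
  also have "\<dots> = (\<Prod>i<N. \<integral>\<^sup>+y. ennreal (1 / (2 * sqrt pi * sqrt (1 - \<alpha>))) *
        ennreal (normal_density 0 (sqrt ((1 + \<alpha>) / 2)) y / (normal_density 0 1 y)\<^sup>2) \<partial>std_normal)"
    by (rule gauss.product_nn_integral_prod) auto
  also have "\<dots> = (\<Prod>i<N. ennreal (1 / (2 * sqrt pi * sqrt (1 - \<alpha>))) * ennreal (2 * sqrt pi / sqrt (1 - \<alpha>)))"
    using \<alpha> by (subst nn_integral_cmult) (auto simp: nn_integral_normal_density_ratio)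
  also have "\<dots> = ennreal (1 / (1 - \<alpha>)) ^ N"
    using \<alpha> by (simp add: ennreal_mult'[symmetric])
  finally show ?thesis
    using \<alpha> by (simp add: ennreal_power \<alpha>_def)
qed

section \<open>Mixtures close to the null\<close>

text \<open>The hypothesis on second moments says that the uniform mixture \<open>B\<close> has
  chi-square divergence at most \<open>\<eta>\<^sup>2\<close> from \<open>M\<close>, so it gives
  \<open>A\<close> at most \<open>\<eta>\<close> more mass than \<open>M\<close> does. If every
  component exceeded that bound, so would their average.\<close>

lemma mixture_close_to_null:
  fixes L :: "'b \<Rightarrow> 'a \<Rightarrow> real" and \<eta> :: real
  assumes "prob_space M" and F: "finite F" "F \<noteq> {}" and \<eta>: "0 < \<eta>"
    and int: "\<And>f. f \<in> F \<Longrightarrow> integrable M (L f)" "\<And>f. f \<in> F \<Longrightarrow> integral\<^sup>L M (L f) = 1"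
    and int2: "\<And>f g. f \<in> F \<Longrightarrow> g \<in> F \<Longrightarrow> integrable M (\<lambda>z. L f z * L g z)"
    and second: "(\<Sum>f\<in>F. \<Sum>g\<in>F. (\<integral>z. L f z * L g z \<partial>M)) \<le> (1 + \<eta>\<^sup>2) * (card F)\<^sup>2"
    and A: "A \<in> sets M"
  shows "\<exists>f\<in>F. (\<integral>z. L f z * indicator A z \<partial>M) \<le> measure M A + \<eta>"
proof (rule ccontr)
  interpret prob_space M by fact
  assume "\<not> ?thesis"
  then have *: "measure M A + \<eta> < (\<integral>z. L f z * indicator A z \<partial>M)" if "f \<in> F" for f
    using that by force
  define n where "n = real (card F)"
  have n: "0 < n" using F by (simp add: n_def card_gt_0_iff)
  define B where "B z = (\<Sum>f\<in>F. L f z) / n" for z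
  have intA: "integrable M (\<lambda>z. L f z * indicator A z)" if "f \<in> F" for f
    using int(1)[OF that] A by (intro integrable_real_mult_indicator)
  have BA: "integrable M (\<lambda>z. B z * indicator A z)"
    "(\<integral>z. B z * indicator A z \<partial>M) = (\<Sum>f\<in>F. \<integral>z. L f z * indicator A z \<partial>M) / n"
    using intA by (simp_all add: B_def sum_distrib_right)
  have B: "integrable M B" "integral\<^sup>L M B = 1"
    using int n unfolding B_def by (simp_all add: n_def)
  have "(B z)\<^sup>2 = (\<Sum>f\<in>F. \<Sum>g\<in>F. L f z * L g z) / n\<^sup>2" for z
    by (simp add: B_def power_divide power2_eq_square sum_product)
  then have B2: "integrable M (\<lambda>z. (B z)\<^sup>2)" "(\<integral>z. (B z)\<^sup>2 \<partial>M) = (\<Sum>f\<in>F. \<Sum>g\<in>F. (\<integral>z. L f z * L g z \<partial>M)) / n\<^sup>2"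
    using int2 by simp_all
  have B2': "(\<integral>z. (B z)\<^sup>2 \<partial>M) \<le> 1 + \<eta>\<^sup>2"
    using second n unfolding B2 by (simp add: n_def[symmetric] divide_le_eq mult.commute)
  have iA: "integrable M (indicator A :: _ \<Rightarrow> real)" "(\<integral>z. indicator A z \<partial>M) = measure M A"
    using A by (auto simp: less_top[symmetric])
  have "(measure M A + \<eta>) * n < (\<Sum>f\<in>F. \<integral>z. L f z * indicator A z \<partial>M)"
    using F sum_strict_mono[OF F, of "\<lambda>_. measure M A + \<eta>"] * by (simp add: n_def mult.commute)
  then have "measure M A + \<eta> < (\<integral>z. B z * indicator A z \<partial>M)"
    unfolding BA using n by (simp add: less_divide_eq)
  also have "(\<integral>z. B z * indicator A z \<partial>M)
     \<le> (\<integral>z. indicator A z + (\<eta> / 2 + ((B z)\<^sup>2 - 2 * B z + 1) / (2 * \<eta>)) \<partial>M)"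
  proof (rule integral_mono)
    fix z
    \<comment> \<open>The AM-GM inequality takes the place of Cauchy-Schwarz: on \<open>A\<close>
      the right side exceeds the left by \<open>(B z - 1 - \<eta>)\<^sup>2 / (2 * \<eta>)\<close>,
      and off \<open>A\<close> by the second quantity.\<close>
    have "0 \<le> (B z - 1 - \<eta>)\<^sup>2 / (2 * \<eta>)" "0 \<le> (B z - 1)\<^sup>2 / (2 * \<eta>) + \<eta> / 2" using \<eta> by simp_all
    then show "B z * indicator A z \<le> indicator A z + (\<eta> / 2 + ((B z)\<^sup>2 - 2 * B z + 1) / (2 * \<eta>))"
      using \<eta> by (auto simp: indicator_def power2_eq_square field_simps)
  qed (use BA(1) iA(1) B B2 in simp_all)
  also have "\<dots> = measure M A + (\<eta> / 2 + ((\<integral>z. (B z)\<^sup>2 \<partial>M) - 1) / (2 * \<eta>))"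
    using iA B B2(1) by (simp add: prob_space)
  also have "((\<integral>z. (B z)\<^sup>2 \<partial>M) - 1) / (2 * \<eta>) \<le> \<eta>\<^sup>2 / (2 * \<eta>)"
    using B2' \<eta> by (intro divide_right_mono) auto
  also have "measure M A + (\<eta> / 2 + \<eta>\<^sup>2 / (2 * \<eta>)) = measure M A + \<eta>"
    using \<eta> by (simp add: power2_eq_square)
  finally show False by simp
qed

section \<open>The block prior\<close>

text \<open>For \<open>f\<close> with values below \<open>m\<close>, one coordinate is chosen from
  each of \<open>s\<close> consecutive blocks of length \<open>m\<close>. The blocks are disjoint,
  so two such supports can meet only where their choices agree within the same block.\<close>

definition block_support :: "nat \<Rightarrow> nat \<Rightarrow> (nat \<Rightarrow> nat) \<Rightarrow> nat set" where
  "block_support s m f = (\<lambda>k. k * m + f k) ` {..<s}"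

lemma block_index_eq_iff:
  fixes a b k l m :: nat
  assumes "a < m" "b < m"
  shows "k * m + a = l * m + b \<longleftrightarrow> k = l \<and> a = b"
proof
  assume eq: "k * m + a = l * m + b"
  have "k = (k * m + a) div m" "l = (l * m + b) div m"
    using assms by simp_all
  then show "k = l \<and> a = b" using eq by auto
qed auto

lemma card_block_support:
  assumes "f \<in> {..<s} \<rightarrow> {..<m}"
  shows "card (block_support s m f) = s"
  unfolding block_support_def using assms
  by (subst card_image) (auto simp: inj_on_def Pi_iff block_index_eq_iff)

lemma block_support_subset:
  assumes "f \<in> {..<s} \<rightarrow> {..<m}" "s * m \<le> p"
  shows "block_support s m f \<subseteq> {..<p}"
proof -
  have "k * m + f k < p" if "k < s" for k
  proof -
    have "k * m + f k < Suc k * m" using assms that by auto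
    also have "\<dots> \<le> s * m" using that by (intro mult_right_mono) auto
    finally show ?thesis using assms(2) by simp
  qed
  then show ?thesis by (auto simp: block_support_def)
qed

lemma card_block_support_Int:
  assumes "f \<in> {..<s} \<rightarrow> {..<m}" "g \<in> {..<s} \<rightarrow> {..<m}"
  shows "card (block_support s m f \<inter> block_support s m g) = card {k \<in> {..<s}. f k = g k}"
proof -
  have eq: "k * m + f k = l * m + g l \<longleftrightarrow> k = l \<and> f k = g l" if "k < s" "l < s" for k l
    using assms that by (intro block_index_eq_iff) auto
  have "block_support s m f \<inter> block_support s m g = (\<lambda>k. k * m + f k) ` {k \<in> {..<s}. f k = g k}"
  proof (intro set_eqI iffI)
    fix j assume "j \<in> block_support s m f \<inter> block_support s m g"
    then obtain k l where "k < s" "l < s" "j = k * m + f k" "j = l * m + g l"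
      by (auto simp: block_support_def)
    with eq[of k l] show "j \<in> (\<lambda>k. k * m + f k) ` {k \<in> {..<s}. f k = g k}"
      by (intro image_eqI[of _ _ k]) auto
  qed (auto simp: block_support_def intro: rev_image_eqI)
  moreover have "inj_on (\<lambda>k. k * m + f k) {k \<in> {..<s}. f k = g k}"
    using assms by (auto simp: inj_on_def Pi_iff block_index_eq_iff)
  ultimately show ?thesis by (simp only: card_image)
qed

text \<open>For independent uniform \<open>f\<close> and \<open>g\<close> the number of agreements is binomial with parameters
  \<open>s\<close> and \<open>1 / m\<close>.\<close>

lemma sum_exp_agreements:
  fixes t :: real and s m :: nat
  assumes "0 < m"
  defines "F \<equiv> {..<s} \<rightarrow>\<^sub>E {..<m}"
  shows "(\<Sum>f\<in>F. \<Sum>g\<in>F. exp (t * card {k \<in> {..<s}. f k = g k})) = (1 + (exp t - 1) / m) ^ s * (card F)\<^sup>2"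
proof -
  \<comment> \<open>As a product over the blocks, the exponential can be summed over
    \<open>g\<close> block by block.\<close>
  have e: "exp (t * card {k \<in> {..<s}. f k = g k}) = (\<Prod>k<s. if f k = g k then exp t else 1)" for f g :: "nat \<Rightarrow> nat"
    by (simp add: prod.If_cases exp_of_nat_mult[symmetric] mult.commute Int_def)
  \<comment> \<open>The inner sum is the same for every \<open>f\<close>: in each block exactly one
    of the \<open>m\<close> choices agrees with \<open>f k\<close>.\<close>
  have "(\<Sum>g\<in>F. exp (t * card {k \<in> {..<s}. f k = g k})) = (real m + (exp t - 1)) ^ s" if f: "f \<in> F" for f
  proof -
    have "(\<Sum>g\<in>F. \<Prod>k<s. if f k = g k then exp t else 1) = (\<Prod>k<s. \<Sum>x<m. if f k = x then exp t else 1)"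
      unfolding F_def by (rule prod_sum_PiE[symmetric]) auto
    also have "\<dots> = (\<Prod>k<s. real m + (exp t - 1))"
    proof (intro prod.cong refl)
      fix k assume "k \<in> {..<s}"
      then have "f k \<in> {..<m}" using f by (auto simp: F_def)
      then have "(\<Sum>x<m. if f k = x then exp t - 1 else 0) = exp t - 1" by (simp add: sum.delta)
      moreover have "(\<Sum>x<m. if f k = x then exp t else 1) = (\<Sum>x<m. 1 + (if f k = x then exp t - 1 else 0))"
        by (intro sum.cong) auto
      ultimately show "(\<Sum>x<m. if f k = x then exp t else 1) = real m + (exp t - 1)"
        by (simp add: sum.distrib)
    qed
    finally show ?thesis unfolding e by simp
  qed
  then have "(\<Sum>f\<in>F. \<Sum>g\<in>F. exp (t * card {k \<in> {..<s}. f k = g k})) = card F * (real m + (exp t - 1)) ^ s"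
    by simp
  also have "real m + (exp t - 1) = m * (1 + (exp t - 1) / m)"
    using assms by (simp add: field_simps)
  also have "real (card F) * (m * (1 + (exp t - 1) / m)) ^ s = (1 + (exp t - 1) / m) ^ s * (card F)\<^sup>2"
    unfolding power_mult_distrib by (simp add: F_def card_PiE power2_eq_square)
  finally show ?thesis .
qed

section \<open>Choosing the block sizes\<close>

text \<open>By convexity the exponential lies below its chord between \<open>0\<close> and
  \<open>l\<close>. This moves the small factor \<open>\<kappa>\<close> out of the exponent.\<close>

lemma exp_scaled_le:
  fixes \<kappa> l :: real
  assumes "0 \<le> \<kappa>" "\<kappa> \<le> 1"
  shows "exp (\<kappa> * l) - 1 \<le> \<kappa> * (exp l - 1)"
proof -
  have "exp ((1 - \<kappa>) *\<^sub>R 0 + \<kappa> *\<^sub>R l) \<le> (1 - \<kappa>) * exp 0 + \<kappa> * exp l"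
    by (rule convex_onD[OF exp_convex]) (use assms in auto)
  then show ?thesis by (simp add: algebra_simps)
qed

text \<open>The last property controls the binomial moment \<open>(1 + (exp u - 1) / m) ^ t\<close>
  with \<open>u = 2 * N * r\<^sup>2 / t\<close>. The radius condition gives
  \<open>u \<le> \<kappa> * ln (1 + q / t)\<close> for \<open>q = sqrt p\<close>, hence
  \<open>exp u - 1 \<le> \<kappa> * (q / t)\<close>, and blocks of length \<open>p div t\<close>
  satisfy \<open>q \<le> 2 * m\<close>.\<close>

lemma block_sizes_exist:
  fixes \<kappa> r :: real
  assumes "1 \<le> N" "2 \<le> p" "1 \<le> s" "s \<le> p" "0 < \<kappa>" "\<kappa> \<le> 1" and r: "r\<^sup>2 \<le> \<kappa> / 8 * (rate p N s)\<^sup>2"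
  obtains t m :: nat where "1 \<le> t" "t \<le> s" "0 < m" "t * m \<le> p"
    "t * ((exp (2 * N * r\<^sup>2 / t) - 1) / m) \<le> 2 * \<kappa>"
proof -
  define q where "q = sqrt (real p)"
  have q: "1 \<le> q" "q\<^sup>2 = p" "0 < q" using assms by (auto simp: q_def)
  define t where "t = min s (nat \<lfloor>q\<rfloor>)"
  have t1: "1 \<le> t" "t \<le> s" "t \<le> p" using assms q by (auto simp: t_def le_nat_iff le_floor_iff)
  have "real (nat \<lfloor>q\<rfloor>) \<le> q" using q by linarith
  then have tq: "real t \<le> q" by (simp add: t_def)
  define h where "h x = x * ln (1 + q / x)" for x :: real
  \<comment> \<open>The price of capping the sparsity. Beyond the cap,
    \<open>ln (1 + x) \<le> x\<close> gives \<open>h s \<le> q\<close>, rounding gives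
    \<open>q \<le> 2 * t\<close>, and \<open>t \<le> q\<close> gives
    \<open>ln (1 + q / t) \<ge> ln 2 \<ge> 1 / 2\<close>.\<close>
  have hs: "h s \<le> 4 * h t"
  proof (cases "s \<le> nat \<lfloor>q\<rfloor>")
    case True
    then have "t = s" by (simp add: t_def)
    moreover have "0 \<le> h s" using q assms by (auto simp: h_def intro!: mult_nonneg_nonneg ln_ge_zero)
    ultimately show ?thesis by simp
  next
    case False
    then have t: "t = nat \<lfloor>q\<rfloor>" by (simp add: t_def)
    have "h s \<le> s * (q / s)" unfolding h_def
      using q assms by (intro mult_left_mono ln_add_one_self_le_self) auto
    also have "\<dots> = q" using assms by simp
    also have "q \<le> 2 * t" using t q t1 by linarith
    also have "\<dots> \<le> 4 * h t"
    proof -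
      have "1 / 2 \<le> ln (2 :: real)" using ln2_ge_two_thirds by simp
      also have "\<dots> \<le> ln (1 + q / t)" using tq t1 by (subst ln_le_cancel_iff) (auto simp: field_simps add_pos_pos)
      finally show ?thesis using t1 by (simp add: h_def)
    qed
    finally show ?thesis .
  qed
  define u where "u = 2 * N * r\<^sup>2 / t"
  have "(rate p N s)\<^sup>2 \<le> h s / N"
  proof -
    have "0 \<le> h s" using q assms by (auto simp: h_def intro!: mult_nonneg_nonneg ln_ge_zero)
    then have "0 \<le> rate p N s" "rate p N s \<le> sqrt (h s / N)"
      by (simp_all add: rate_def h_def q_def)
    then have "(rate p N s)\<^sup>2 \<le> (sqrt (h s / N))\<^sup>2" by (intro power_mono) auto
    also have "\<dots> = h s / N" using \<open>0 \<le> h s\<close> by simp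
    finally show ?thesis .
  qed
  then have "r\<^sup>2 \<le> \<kappa> / 8 * (h s / N)"
    using r assms by (meson mult_left_mono order_trans zero_le_divide_iff less_imp_le zero_le_numeral)
  also have "\<dots> \<le> \<kappa> / 8 * (4 * h t / N)"
    using hs assms by (intro mult_left_mono divide_right_mono) auto
  \<comment> \<open>The 8 in the radius condition absorbs the 2 in \<open>u\<close> and the 4 in
    \<open>hs\<close>.\<close>
  finally have "u \<le> \<kappa> * ln (1 + q / t)"
    using assms t1 by (simp add: u_def h_def field_simps)
  then have "exp u - 1 \<le> exp (\<kappa> * ln (1 + q / t)) - 1" by simp
  also have "\<dots> \<le> \<kappa> * (exp (ln (1 + q / t)) - 1)"
    using assms by (intro exp_scaled_le) auto
  also have "\<dots> = \<kappa> * (q / t)"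
    using q t1 by (simp add: add_pos_nonneg)
  finally have u: "t * (exp u - 1) \<le> \<kappa> * q"
    using t1 by (simp add: field_simps)
  \<comment> \<open>Rounding loses at most a factor 2:
    \<open>p < t * (m + 1) \<le> 2 * t * m\<close>, and \<open>t \<le> q\<close> then yields
    \<open>q \<le> 2 * m\<close>.\<close>
  define m where "m = p div t"
  have m: "0 < m" "t * m \<le> p" using t1 by (auto simp: m_def div_greater_zero_iff)
  have "p < t * (m + 1)" using t1 unfolding m_def
    by (metis Suc_eq_plus1 dividend_less_times_div mult_Suc_right less_le_trans zero_less_one add.commute)
  also have "\<dots> \<le> t * (2 * m)" using m by (intro mult_left_mono) auto
  finally have "real p < real (t * (2 * m))" by (simp only: of_nat_less_iff)
  also have "\<dots> = real t * (2 * real m)" by simp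
  also have "\<dots> \<le> q * (2 * real m)" using tq by (intro mult_right_mono) auto
  finally have "q * q \<le> q * (2 * real m)" using q by (simp add: power2_eq_square)
  then have "q \<le> 2 * real m" using q by simp
  then have "\<kappa> * q \<le> \<kappa> * (2 * real m)" using assms by (intro mult_left_mono) auto
  with u have "t * ((exp u - 1) / m) \<le> 2 * \<kappa>"
    using m by (simp add: field_simps)
  with t1 m show ?thesis by (intro that[of t m]) (auto simp: u_def)
qed

section \<open>Alternatives that are hard to tell from the null\<close>

text \<open>This turns the second moment, a power of \<open>1 / (1 - x)\<close>, into an exponential
  of the number of agreements. On this range \<open>x\<^sup>2 \<le> x / 2\<close>, so
  \<open>ln (1 - x) \<ge> - x - 2 * x\<^sup>2 \<ge> - 2 * x\<close>.\<close>

lemma inverse_one_minus_le_exp: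
  fixes x :: real
  assumes "0 \<le> x" "x \<le> 1 / 2"
  shows "1 / (1 - x) \<le> exp (2 * x)"
proof -
  have "x\<^sup>2 \<le> x * (1 / 2)"
    unfolding power2_eq_square using assms by (intro mult_left_mono) auto
  then have "- (2 * x) \<le> ln (1 - x)"
    using ln_one_minus_pos_lower_bound[OF assms] by linarith
  then have "exp (- (2 * x)) \<le> 1 - x"
    using assms by (simp add: ln_ge_iff)
  then show ?thesis
    using assms by (simp add: exp_minus field_simps)
qed

lemma vnorm_flat_vec:
  assumes "S \<subseteq> {..<p}" "0 \<le> a"
  shows "vnorm p (flat_vec p S a) = sqrt (card S) * a"
proof -
  have "(\<Sum>j<p. (flat_vec p S a j)\<^sup>2) = (\<Sum>j\<in>S. a\<^sup>2)"
    using assms by (intro sum.mono_neutral_cong_right) (auto simp: flat_vec_def)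
  then show ?thesis
    using assms by (simp add: vnorm_def L2_set_def real_sqrt_mult)
qed

lemma flat_vec_in_B0:
  assumes "S \<subseteq> {..<p}" "card S \<le> s"
  shows "flat_vec p S a \<in> B0 p s"
proof -
  have "card {j \<in> {..<p}. flat_vec p S a j \<noteq> 0} \<le> card S"
    using assms by (intro card_mono) (auto simp: flat_vec_def intro: finite_subset)
  then show ?thesis
    using assms by (auto simp: B0_def flat_vec_def)
qed

lemma lik_ratio_integral:
  assumes "0 < \<sigma>"
  shows "integrable (design_noise N p) (lik_ratio N p \<theta> \<sigma>)"
    "integral\<^sup>L (design_noise N p) (lik_ratio N p \<theta> \<sigma>) = 1"
proof -
  interpret P: prob_space "model_law N p \<theta> \<sigma>" by (rule prob_space_model_law)
  have "(\<integral>\<^sup>+z. ennreal (lik_ratio N p \<theta> \<sigma> z) \<partial>design_noise N p)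
      = (\<integral>\<^sup>+z. ennreal (lik_ratio N p \<theta> \<sigma> z) * indicator (space (obs_space N p)) z \<partial>design_noise N p)"
    by (intro nn_integral_cong) simp
  also have "\<dots> = emeasure (model_law N p \<theta> \<sigma>) (space (obs_space N p))"
    unfolding model_law_eq_density[OF assms] by (intro emeasure_density[symmetric]) auto
  also have "\<dots> = ennreal 1"
    using P.emeasure_space_1 by simp
  finally have "(\<integral>\<^sup>+z. ennreal (lik_ratio N p \<theta> \<sigma> z) \<partial>design_noise N p) = ennreal 1" .
  then show "integrable (design_noise N p) (lik_ratio N p \<theta> \<sigma>)"
    "integral\<^sup>L (design_noise N p) (lik_ratio N p \<theta> \<sigma>) = 1"
    by (auto intro!: integrableI_nn_integral_finite integral_eq_nn_integral[THEN trans] simp: lik_ratio_nonneg)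
qed

lemma measure_model_law:
  assumes "0 < \<sigma>" and A: "A \<in> sets (obs_space N p)"
  shows "measure (model_law N p \<theta> \<sigma>) A = (\<integral>z. lik_ratio N p \<theta> \<sigma> z * indicator A z \<partial>design_noise N p)"
proof -
  have "emeasure (model_law N p \<theta> \<sigma>) A = (\<integral>\<^sup>+z. ennreal (lik_ratio N p \<theta> \<sigma> z * indicator A z) \<partial>design_noise N p)"
    unfolding model_law_eq_density[OF assms(1)] using A
    by (subst emeasure_density) (auto intro!: nn_integral_cong simp: ennreal_mult' lik_ratio_nonneg ennreal_indicator[symmetric])
  also have "\<dots> = ennreal (\<integral>z. lik_ratio N p \<theta> \<sigma> z * indicator A z \<partial>design_noise N p)"
    using A lik_ratio_integral(1)[OF assms(1)]
    by (intro nn_integral_eq_integral integrable_real_mult_indicator) (auto simp: lik_ratio_nonneg)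
  finally show ?thesis
    by (simp add: measure_def lik_ratio_nonneg integral_nonneg_AE)
qed

lemma lik_ratio_product_integral:
  fixes a \<sigma> :: real
  assumes "S \<subseteq> {..<p}" "T \<subseteq> {..<p}" "card S = card T" "0 < \<sigma>" "card S * a\<^sup>2 + \<sigma>\<^sup>2 = 1"
  shows "integrable (design_noise N p) (\<lambda>z. lik_ratio N p (flat_vec p S a) \<sigma> z * lik_ratio N p (flat_vec p T a) \<sigma> z)"
    "(\<integral>z. lik_ratio N p (flat_vec p S a) \<sigma> z * lik_ratio N p (flat_vec p T a) \<sigma> z \<partial>design_noise N p)
      = (1 / (1 - card (S \<inter> T) * a\<^sup>2)) ^ N"
proof -
  have "card (S \<inter> T) \<le> card S"
    using assms(1) by (intro card_mono finite_subset[OF assms(1)]) auto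
  then have "card (S \<inter> T) * a\<^sup>2 \<le> card S * a\<^sup>2" by (intro mult_right_mono) auto
  then have "0 \<le> (1 / (1 - card (S \<inter> T) * a\<^sup>2)) ^ N"
    using assms(5) zero_le_power2[of \<sigma>] by (intro zero_le_power divide_nonneg_nonneg) linarith+
  then show "integrable (design_noise N p) (\<lambda>z. lik_ratio N p (flat_vec p S a) \<sigma> z * lik_ratio N p (flat_vec p T a) \<sigma> z)"
    "(\<integral>z. lik_ratio N p (flat_vec p S a) \<sigma> z * lik_ratio N p (flat_vec p T a) \<sigma> z \<partial>design_noise N p)
      = (1 / (1 - card (S \<inter> T) * a\<^sup>2)) ^ N"
    using nn_integral_lik_ratio_product[OF assms, of N]
    by (auto intro!: integrableI_nn_integral_finite integral_eq_nn_integral[THEN trans] simp: lik_ratio_nonneg)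
qed

lemma rate_pos:
  assumes "1 \<le> N" "2 \<le> p" "1 \<le> s"
  shows "0 < rate p N s"
  using assms by (auto simp: rate_def intro!: divide_pos_pos mult_pos_pos ln_gt_zero)

lemma rate_le_1: "rate p N s \<le> 1"
  by (simp add: rate_def)

lemma sparse_alternative_close_to_null:
  fixes \<eta> r :: real
  assumes N: "1 \<le> N" and p: "2 \<le> p" and s: "1 \<le> s" "s \<le> p" and \<eta>: "0 < \<eta>" "\<eta> \<le> 1"
    and r: "0 \<le> r" "r\<^sup>2 \<le> ln (1 + \<eta>\<^sup>2) / 16 * (rate p N s)\<^sup>2"
    and A: "A \<in> sets (obs_space N p)"
  shows "\<exists>\<theta>\<in>B0 p s. vnorm p \<theta> = r \<and>
    measure (model_law N p \<theta> (sqrt (1 - r\<^sup>2))) A \<le> measure (model_law N p (zero_vec p) 1) A + \<eta>"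
proof -
  \<comment> \<open>Chosen so that \<open>exp (2 * \<kappa>)\<close> is
    \<open>1 + \<eta>\<^sup>2\<close>, the second moment that \<open>mixture_close_to_null\<close>
    tolerates.\<close>
  define \<kappa> where "\<kappa> = ln (1 + \<eta>\<^sup>2) / 2"
  have \<eta>2: "0 < \<eta>\<^sup>2" "\<eta>\<^sup>2 \<le> 1" using \<eta> by (simp_all add: power_le_one)
  have "ln (1 + \<eta>\<^sup>2) \<le> \<eta>\<^sup>2" by (rule ln_add_one_self_le_self) simp
  then have \<kappa>: "0 < \<kappa>" "\<kappa> \<le> 1" "exp (2 * \<kappa>) = 1 + \<eta>\<^sup>2"
    using \<eta>2 by (auto simp: \<kappa>_def add_pos_pos)
  have r': "r\<^sup>2 \<le> \<kappa> / 8 * (rate p N s)\<^sup>2"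
    using r(2) by (simp add: \<kappa>_def)
  \<comment> \<open>Here the cap 1 in \<open>rate\<close> enters. The resulting
    \<open>r\<^sup>2 \<le> 1 / 2\<close> keeps the noise level positive and puts each
    \<open>K * a\<^sup>2 \<le> r\<^sup>2\<close> in the range of
    \<open>inverse_one_minus_le_exp\<close>.\<close>
  also have "\<dots> \<le> 1 / 8 * 1"
    using \<kappa> rate_pos[OF N p s(1)] rate_le_1[of p N s] by (intro mult_mono power_le_one) auto
  finally have r2: "r\<^sup>2 \<le> 1 / 2" by simp
  define \<sigma> where "\<sigma> = sqrt (1 - r\<^sup>2)"
  have \<sigma>: "0 < \<sigma>" "\<sigma>\<^sup>2 = 1 - r\<^sup>2" using r2 by (simp_all add: \<sigma>_def)
  obtain t m where t: "1 \<le> t" "t \<le> s" and m: "0 < m" "t * m \<le> p"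
    and tm: "t * ((exp (2 * real N * r\<^sup>2 / t) - 1) / m) \<le> 2 * \<kappa>"
    by (rule block_sizes_exist[OF N p s \<kappa>(1,2) r'])
  define u where "u = 2 * real N * r\<^sup>2 / t"
  \<comment> \<open>With \<open>t\<close> entries of this size the vector has norm
    \<open>r\<close>.\<close>
  define a where "a = r / sqrt t"
  have a: "0 \<le> a" "t * a\<^sup>2 = r\<^sup>2" using r t by (simp_all add: a_def power_divide)
  define F where "F = {..<t} \<rightarrow>\<^sub>E {..<m}"
  define S where "S f = block_support t m f" for f
  define L where "L f = lik_ratio N p (flat_vec p (S f) a) \<sigma>" for f
  have F: "finite F" "F \<noteq> {}"
    using m by (auto simp: F_def PiE_eq_empty_iff intro!: finite_PiE)
  have S: "S f \<subseteq> {..<p}" "card (S f) = t" if "f \<in> F" for f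
    using that m block_support_subset[of f t m p] card_block_support[of f t m]
    by (auto simp: S_def F_def PiE_def)
  have Lint: "integrable (design_noise N p) (\<lambda>z. L f z * L g z)"
    "(\<integral>z. L f z * L g z \<partial>design_noise N p) \<le> exp (u * card {k \<in> {..<t}. f k = g k})"
    if fg: "f \<in> F" "g \<in> F" for f g
  proof -
    have "card (S f) = card (S g)" "card (S f) * a\<^sup>2 + \<sigma>\<^sup>2 = 1"
      using S fg a \<sigma> by simp_all
    note * = lik_ratio_product_integral[OF S(1)[OF fg(1)] S(1)[OF fg(2)] this(1) \<sigma>(1) this(2), of N, folded L_def]
    show "integrable (design_noise N p) (\<lambda>z. L f z * L g z)" by (rule *)
    define K where "K = card {k \<in> {..<t}. f k = g k}"
    have cK: "card (S f \<inter> S g) = K"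
      unfolding S_def K_def using fg by (intro card_block_support_Int) (auto simp: F_def PiE_def)
    have "K \<le> card {..<t}" unfolding K_def by (intro card_mono) auto
    then have "K * a\<^sup>2 \<le> t * a\<^sup>2" by (intro mult_right_mono) auto
    then have "1 / (1 - K * a\<^sup>2) \<le> exp (2 * (K * a\<^sup>2))" and pos: "0 < 1 - K * a\<^sup>2"
      using r2 a by (auto intro!: inverse_one_minus_le_exp)
    then have "(1 / (1 - K * a\<^sup>2)) ^ N \<le> exp (2 * (K * a\<^sup>2)) ^ N"
      by (intro power_mono) auto
    also have "\<dots> = exp (u * K)"
    proof -
      have "u = 2 * real N * a\<^sup>2"
        using t by (simp add: u_def flip: a(2))
      then show ?thesis
        by (simp add: exp_of_nat_mult[symmetric] mult_ac)
    qed
    finally show "(\<integral>z. L f z * L g z \<partial>design_noise N p) \<le> exp (u * card {k \<in> {..<t}. f k = g k})"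
      unfolding K_def[symmetric] *(2) cK .
  qed
  have "0 \<le> (exp u - 1) / m"
    by (simp add: u_def)
  \<comment> \<open>By \<open>1 + x \<le> exp x\<close> the moment is at most
    \<open>exp (t * x)\<close> with \<open>x = (exp u - 1) / m\<close>, and the block sizes keep
    \<open>t * x\<close> below \<open>2 * \<kappa>\<close>.\<close>
  then have "(1 + (exp u - 1) / m) ^ t \<le> exp ((exp u - 1) / m) ^ t"
    by (intro power_mono exp_ge_add_one_self) auto
  also have "\<dots> = exp (t * ((exp u - 1) / m))" by (rule exp_of_nat_mult[symmetric])
  also have "\<dots> \<le> 1 + \<eta>\<^sup>2" using tm by (simp only: \<kappa>(3)[symmetric] u_def exp_le_cancel_iff)
  finally have moment: "(1 + (exp u - 1) / m) ^ t \<le> 1 + \<eta>\<^sup>2" .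
  have "(\<Sum>f\<in>F. \<Sum>g\<in>F. (\<integral>z. L f z * L g z \<partial>design_noise N p))
      \<le> (\<Sum>f\<in>F. \<Sum>g\<in>F. exp (u * card {k \<in> {..<t}. f k = g k}))"
    by (intro sum_mono Lint)
  also have "\<dots> = (1 + (exp u - 1) / m) ^ t * (card F)\<^sup>2"
    unfolding F_def using m(1) by (rule sum_exp_agreements)
  also have "\<dots> \<le> (1 + \<eta>\<^sup>2) * (card F)\<^sup>2"
    using moment by (intro mult_right_mono) auto
  finally have "\<exists>f\<in>F. (\<integral>z. L f z * indicator A z \<partial>design_noise N p) \<le> measure (design_noise N p) A + \<eta>"
    using A lik_ratio_integral[OF \<sigma>(1)]
    by (intro mixture_close_to_null[OF prob_space_design_noise F \<eta>(1)] Lint(1)) (auto simp: L_def)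
  then obtain f where f: "f \<in> F"
    and le: "(\<integral>z. L f z * indicator A z \<partial>design_noise N p) \<le> measure (design_noise N p) A + \<eta>"
    by blast
  show ?thesis
  proof (intro bexI conjI)
    show "vnorm p (flat_vec p (S f) a) = r"
      using S[OF f] a t by (simp add: vnorm_flat_vec a_def)
    show "measure (model_law N p (flat_vec p (S f) a) (sqrt (1 - r\<^sup>2))) A \<le> measure (model_law N p (zero_vec p) 1) A + \<eta>"
      using le by (simp add: model_law_null measure_model_law[OF \<sigma>(1) A] L_def flip: \<sigma>_def)
    show "flat_vec p (S f) a \<in> B0 p s"
      using S[OF f] t by (intro flat_vec_in_B0) auto
  qed
qed

section \<open>Lower bounds for tests and estimators\<close>

text \<open>The two suprema in the risk are bounded below by single terms: the null with unit noise
  and the alternative built for the rejection event \<open>A\<close> of the test. The alternative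
  gives \<open>A\<close> at most \<open>\<eta>\<close> more mass than the null, so the two error
  probabilities add up to at least \<open>1 - \<eta>\<close>.\<close>

lemma minimax_test_risk_ge:
  fixes \<eta> \<rho> :: real
  assumes N: "1 \<le> N" and p: "2 \<le> p" and s: "1 \<le> s" "s \<le> p" and \<eta>: "0 < \<eta>" "\<eta> \<le> 1"
    and \<rho>: "0 < \<rho>" "\<rho>\<^sup>2 \<le> ln (1 + \<eta>\<^sup>2) / 16 * (rate p N s)\<^sup>2"
  shows "ennreal (1 - \<eta>) \<le> minimax_test_risk p N s \<rho>"
  unfolding minimax_test_risk_def
proof (rule INF_greatest)
  fix \<Delta> assume "\<Delta> \<in> tests N p"
  then have \<Delta>[measurable]: "\<Delta> \<in> measurable (obs_space N p) (count_space {0, 1})"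
    by (simp add: tests_def)
  define A where "A = {z \<in> space (obs_space N p). \<Delta> z = 1}"
  have A: "A \<in> sets (obs_space N p)" unfolding A_def by measurable
  have compl: "{z \<in> space (obs_space N p). \<Delta> z = 0} = space (obs_space N p) - A"
    using measurable_space[OF \<Delta>] by (auto simp: A_def)
  \<comment> \<open>The separation is measured in units of the noise level, which itself depends on
    \<open>r\<close>. This \<open>r\<close> solves \<open>r = \<sigma> * \<rho>\<close> with
    \<open>\<sigma>\<^sup>2 = 1 - r\<^sup>2\<close>.\<close>
  define r where "r = \<rho> / sqrt (1 + \<rho>\<^sup>2)"
  define \<sigma> where "\<sigma> = sqrt (1 - r\<^sup>2)"
  have q: "0 < 1 + \<rho>\<^sup>2" by (simp add: add_pos_nonneg)
  then have r2: "r\<^sup>2 = \<rho>\<^sup>2 / (1 + \<rho>\<^sup>2)" by (simp add: r_def power_divide)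
  then have "1 - r\<^sup>2 = 1 / (1 + \<rho>\<^sup>2)" using q by (simp add: field_simps)
  then have \<sigma>: "\<sigma> = 1 / sqrt (1 + \<rho>\<^sup>2)" by (simp add: \<sigma>_def real_sqrt_divide)
  then have \<sigma>0: "0 < \<sigma>" "\<sigma> * \<rho> \<le> r" using q by (simp_all add: r_def)
  have "r\<^sup>2 \<le> \<rho>\<^sup>2"
    unfolding r2 using q by (simp add: divide_le_eq algebra_simps)
  then have r_small: "r\<^sup>2 \<le> ln (1 + \<eta>\<^sup>2) / 16 * (rate p N s)\<^sup>2"
    using \<rho>(2) by (rule order_trans)
  have "0 \<le> r" using \<rho> q by (simp add: r_def)
  then obtain \<theta> where \<theta>: "\<theta> \<in> B0 p s" "vnorm p \<theta> = r"
    and le: "measure (model_law N p \<theta> \<sigma>) A \<le> measure (model_law N p (zero_vec p) 1) A + \<eta>"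
    using sparse_alternative_close_to_null[OF N p s \<eta> _ r_small A] \<open>0 \<le> r\<close> by (auto simp: \<sigma>_def)
  interpret P0: prob_space "model_law N p (zero_vec p) 1" by (rule prob_space_model_law)
  interpret P1: prob_space "model_law N p \<theta> \<sigma>" by (rule prob_space_model_law)
  have "1 - \<eta> \<le> measure (model_law N p (zero_vec p) 1) A + measure (model_law N p \<theta> \<sigma>) (space (obs_space N p) - A)"
    using le A P1.prob_compl[of A] by simp
  then have "ennreal (1 - \<eta>) \<le> ennreal (measure (model_law N p (zero_vec p) 1) A)
      + ennreal (measure (model_law N p \<theta> \<sigma>) (space (obs_space N p) - A))"
    by (simp add: ennreal_leI flip: ennreal_plus)
  also have "\<dots> = emeasure (model_law N p (zero_vec p) 1) A + emeasure (model_law N p \<theta> \<sigma>) (space (obs_space N p) - A)"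
    by (simp add: P0.emeasure_eq_measure P1.emeasure_eq_measure)
  also have "\<dots> \<le> risk \<Delta> p N s \<rho>"
    unfolding risk_def A_def[symmetric] compl
    using \<sigma>0 \<theta> by (intro add_mono SUP_upper2[of 1] SUP_upper2[of \<sigma>] SUP_upper2[of \<theta>]) auto
  finally show "ennreal (1 - \<eta>) \<le> risk \<Delta> p N s \<rho>" .
qed

text \<open>The events that \<open>T\<close> is accurate at the \<open>M\<close> radii
  \<open>k * d\<close> are disjoint, so their null probabilities sum to at most 1. Passing to the
  alternatives costs \<open>\<eta>\<close> each, hence at some radius \<open>T\<close> is accurate
  with probability at most \<open>1 / M + \<eta>\<close>.\<close>

lemma minimax_estimation_error_ge:
  fixes \<eta> c :: real and M :: nat
  assumes N: "1 \<le> N" and p: "2 \<le> p" and s: "1 \<le> s" "s \<le> p" and \<eta>: "0 < \<eta>" "\<eta> \<le> 1"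
    and M: "0 < M" and c: "0 < c" "(M * c)\<^sup>2 \<le> ln (1 + \<eta>\<^sup>2) / 16"
  shows "ennreal (1 - 1 / M - \<eta>) \<le> minimax_estimation_error p N s (c / 2 * rate p N s)"
  unfolding minimax_estimation_error_def
proof (rule INF_greatest)
  fix T assume "T \<in> estimators N p"
  then have [measurable]: "T \<in> borel_measurable (obs_space N p)"
    by (simp add: estimators_def)
  define d where "d = c * rate p N s"
  have d: "0 < d" "c / 2 * rate p N s = d / 2" using c rate_pos[OF N p s(1)] by (simp_all add: d_def)
  define r where "r k = real k * d" for k
  define \<sigma> where "\<sigma> k = sqrt (1 - (r k)\<^sup>2)" for k
  define G where "G k = {z \<in> space (obs_space N p). \<bar>T z - r k\<bar> \<le> \<sigma> k * (d / 2)}" for k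
  have G: "G k \<in> sets (obs_space N p)" for k unfolding G_def by measurable
  have r_small: "(r k)\<^sup>2 \<le> ln (1 + \<eta>\<^sup>2) / 16 * (rate p N s)\<^sup>2" if "k < M" for k
  proof -
    have "(r k)\<^sup>2 = (k * c)\<^sup>2 * (rate p N s)\<^sup>2" by (simp add: r_def d_def power_mult_distrib)
    also have "(k * c)\<^sup>2 \<le> (M * c)\<^sup>2" using that c by (intro power_mono mult_right_mono) auto
    finally show ?thesis using c(2) by (meson mult_right_mono order_trans zero_le_power2)
  qed
  \<comment> \<open>Each radius gets its own vector, chosen against the accuracy event
    \<open>G k\<close>.\<close>
  have "\<exists>\<theta>. \<forall>k<M. \<theta> k \<in> B0 p s \<and> vnorm p (\<theta> k) = r k \<and>
     measure (model_law N p (\<theta> k) (\<sigma> k)) (G k) \<le> measure (model_law N p (zero_vec p) 1) (G k) + \<eta>"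
  proof (intro choice allI)
    fix k
    show "\<exists>\<theta>. k < M \<longrightarrow> \<theta> \<in> B0 p s \<and> vnorm p \<theta> = r k \<and>
     measure (model_law N p \<theta> (\<sigma> k)) (G k) \<le> measure (model_law N p (zero_vec p) 1) (G k) + \<eta>"
      using sparse_alternative_close_to_null[OF N p s \<eta> _ r_small G] d(1)
      unfolding \<sigma>_def by (cases "k < M") (auto simp: r_def)
  qed
  then obtain \<theta> where \<theta>: "\<And>k. k < M \<Longrightarrow> \<theta> k \<in> B0 p s" "\<And>k. k < M \<Longrightarrow> vnorm p (\<theta> k) = r k"
    and le: "\<And>k. k < M \<Longrightarrow> measure (model_law N p (\<theta> k) (\<sigma> k)) (G k)
      \<le> measure (model_law N p (zero_vec p) 1) (G k) + \<eta>"
    by blast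
  have r_lt_1: "(r k)\<^sup>2 < 1" if "k < M" for k
  proof -
    have "\<eta>\<^sup>2 \<le> 1" using \<eta> by (simp add: power_le_one)
    then have "ln (1 + \<eta>\<^sup>2) / 16 \<le> 1 / 16"
      using ln_add_one_self_le_self[of "\<eta>\<^sup>2"] by simp
    then have "ln (1 + \<eta>\<^sup>2) / 16 * (rate p N s)\<^sup>2 \<le> 1 / 16 * 1"
      using rate_pos[OF N p s(1)] rate_le_1[of p N s] by (intro mult_mono power_le_one) auto
    with r_small[OF that] show ?thesis by simp
  qed
  have disj: "G k \<inter> G l = {}" if "k < l" "l < M" for k l
  proof -
    have "0 < r l" using that d by (simp add: r_def)
    then have "\<sigma> l < 1" "\<sigma> k \<le> 1" by (simp_all add: \<sigma>_def)
    \<comment> \<open>The tolerance intervals are closed and neighbouring centres are only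
      \<open>d\<close> apart, so one half-width must be strictly below \<open>d / 2\<close>. The
      larger radius is positive, which gives \<open>\<sigma> l < 1\<close>; at radius 0 the noise
      level is exactly 1.\<close>
    then have "\<sigma> l * (d / 2) < 1 * (d / 2)" "\<sigma> k * (d / 2) \<le> 1 * (d / 2)"
      using d by (intro mult_strict_right_mono mult_right_mono; simp)+
    moreover have "r k + d \<le> r l"
    proof -
      have "real (k + 1) * d \<le> real l * d" using that d by (intro mult_right_mono) auto
      then show ?thesis by (simp add: r_def algebra_simps)
    qed
    ultimately have False if "\<bar>x - r k\<bar> \<le> \<sigma> k * (d / 2)" "\<bar>x - r l\<bar> \<le> \<sigma> l * (d / 2)" for x
      using that by argo
    then show ?thesis by (auto simp: G_def)
  qed
  have dF: "disjoint_family_on G {..<M}"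
    unfolding disjoint_family_on_def using disj by (metis Int_commute lessThan_iff linorder_neqE_nat)
  interpret P0: prob_space "model_law N p (zero_vec p) 1" by (rule prob_space_model_law)
  have "(\<Sum>k<M. measure (model_law N p (\<theta> k) (\<sigma> k)) (G k)) \<le> (\<Sum>k<M. P0.prob (G k) + \<eta>)"
    by (intro sum_mono le) auto
  also have "\<dots> = P0.prob (\<Union>k<M. G k) + M * \<eta>"
    using G dF by (subst P0.finite_measure_finite_Union) (auto simp: sum.distrib)
  also have "\<dots> \<le> 1 + M * \<eta>" by simp
  also have "\<dots> = (\<Sum>k<M. 1 / M + \<eta>)" using M by (simp add: field_simps)
  finally obtain k where k: "k < M" "measure (model_law N p (\<theta> k) (\<sigma> k)) (G k) \<le> 1 / M + \<eta>"
    using sum_strict_mono[of "{..<M}" "\<lambda>_. 1 / M + \<eta>" "\<lambda>k. measure (model_law N p (\<theta> k) (\<sigma> k)) (G k)"] M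
    by (force simp: not_le)
  interpret Pk: prob_space "model_law N p (\<theta> k) (\<sigma> k)" by (rule prob_space_model_law)
  have eq: "space (obs_space N p) - G k = {z \<in> space (obs_space N p). \<bar>T z - vnorm p (\<theta> k)\<bar> > \<sigma> k * (d / 2)}"
    using \<theta>(2)[OF k(1)] by (auto simp: G_def)
  have "ennreal (1 - 1 / M - \<eta>) \<le> ennreal (Pk.prob (space (obs_space N p) - G k))"
    using k G Pk.prob_compl[of "G k"] by (intro ennreal_leI) simp
  also have "\<dots> = emeasure (model_law N p (\<theta> k) (\<sigma> k)) {z \<in> space (obs_space N p). \<bar>T z - vnorm p (\<theta> k)\<bar> > \<sigma> k * (d / 2)}"
    by (simp add: Pk.emeasure_eq_measure eq)
  also have "\<dots> \<le> (SUP \<sigma>\<in>{0<..}. SUP \<theta>\<in>B0 p s.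
        emeasure (model_law N p \<theta> \<sigma>) {z \<in> space (obs_space N p). \<bar>T z - vnorm p \<theta>\<bar> > \<sigma> * (d / 2)})"
    using r_lt_1[OF k(1)] \<theta>(1)[OF k(1)]
    by (intro SUP_upper2[of "\<sigma> k"] SUP_upper2[of "\<theta> k"]) (auto simp: \<sigma>_def)
  finally show "ennreal (1 - 1 / M - \<eta>) \<le> (SUP \<sigma>\<in>{0<..}. SUP \<theta>\<in>B0 p s.
        emeasure (model_law N p \<theta> \<sigma>) {z \<in> space (obs_space N p). \<bar>T z - vnorm p \<theta>\<bar> > \<sigma> * (c / 2 * rate p N s)})"
    by (simp only: d(2))
qed

theorem theorem6:
  fixes \<delta> :: real
  assumes "0 < \<delta>" and "\<delta> < 1"
  shows "\<exists>c>0. \<forall>N p s :: nat. N \<ge> 1 \<longrightarrow> p \<ge> 2 \<longrightarrow> 1 \<le> s \<longrightarrow> s \<le> p \<longrightarrow>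
    (\<forall>\<rho>. 0 < \<rho> \<and> \<rho> \<le> c * rate p N s \<longrightarrow> minimax_test_risk p N s \<rho> \<ge> ennreal \<delta>) \<and>
    separation_rate p N s \<delta> \<ge> ennreal (c * rate p N s) \<and>
    minimax_estimation_error p N s (c / 2 * rate p N s) \<ge> ennreal \<delta>"
proof -
  \<comment> \<open>Half of the gap: \<open>1 - \<eta>\<close> is strictly above
    \<open>\<delta>\<close>, and with \<open>1 / M \<le> \<eta>\<close> the estimation bound
    \<open>1 - 1 / M - \<eta>\<close> is at least \<open>1 - 2 * \<eta> = \<delta>\<close>.\<close>
  define \<eta> where "\<eta> = (1 - \<delta>) / 2"
  have \<eta>: "0 < \<eta>" "\<eta> \<le> 1" using assms by (simp_all add: \<eta>_def)
  define b where "b = ln (1 + \<eta>\<^sup>2) / 16"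
  have b: "0 < b" using \<eta> by (auto simp: b_def intro!: divide_pos_pos ln_gt_zero)
  obtain M :: nat where M: "1 / \<eta> < M" using reals_Archimedean2 by blast
  have M0: "0 < M" using M \<eta> by (auto intro!: gr0I simp: field_simps)
  have M1: "1 / M \<le> \<eta>" using M M0 \<eta> by (simp add: field_simps)
  \<comment> \<open>The same constant serves tests and estimators: all \<open>M\<close> grid radii
    lie below \<open>M * c * rate p N s\<close>, and \<open>M * c = sqrt b\<close> is the largest
    multiple of the rate that the closeness result allows.\<close>
  define c where "c = sqrt b / M"
  have c: "0 < c" "(M * c)\<^sup>2 = b" "c \<le> sqrt b"
    using b M0 by (simp_all add: c_def divide_le_eq mult_left_mono[of 1, simplified])
  show ?thesis
  proof (intro exI[of _ c] conjI allI impI c(1))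
    fix N p s :: nat
    assume Np: "N \<ge> 1" "p \<ge> 2" "1 \<le> s" "s \<le> p"
    have risk: "ennreal (1 - \<eta>) \<le> minimax_test_risk p N s \<rho>" if "0 < \<rho>" "\<rho> \<le> c * rate p N s" for \<rho>
    proof (rule minimax_test_risk_ge[OF Np \<eta> that(1)])
      have "\<rho> \<le> sqrt b * rate p N s"
        using that c(3) rate_pos[OF Np(1-3)] by (meson less_imp_le mult_right_mono order_trans)
      then have "\<rho>\<^sup>2 \<le> (sqrt b * rate p N s)\<^sup>2" using that by (intro power_mono) auto
      then show "\<rho>\<^sup>2 \<le> ln (1 + \<eta>\<^sup>2) / 16 * (rate p N s)\<^sup>2"
        using b by (simp add: power_mult_distrib flip: b_def)
    qed
    \<comment> \<open>Strictness matters for the separation rate, whose admissible radii include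
      those with risk exactly \<open>\<delta>\<close>.\<close>
    have \<delta>: "ennreal \<delta> < ennreal (1 - \<eta>)"
      using assms by (intro ennreal_lessI) (auto simp: \<eta>_def field_simps)
    show "ennreal \<delta> \<le> minimax_test_risk p N s \<rho>" if "0 < \<rho> \<and> \<rho> \<le> c * rate p N s" for \<rho>
      using risk[of \<rho>] that \<delta> by auto
    show "ennreal (c * rate p N s) \<le> separation_rate p N s \<delta>"
      unfolding separation_rate_def
    proof (rule INF_greatest)
      fix \<rho> assume "\<rho> \<in> {\<rho>. 0 < \<rho> \<and> minimax_test_risk p N s \<rho> \<le> ennreal \<delta>}"
      then have "\<not> \<rho> \<le> c * rate p N s" using risk[of \<rho>] \<delta> by auto
      then show "ennreal (c * rate p N s) \<le> ennreal \<rho>" by (intro ennreal_leI) simp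
    qed
    have "ennreal \<delta> \<le> ennreal (1 - 1 / M - \<eta>)"
      using M1 by (intro ennreal_leI) (simp add: \<eta>_def field_simps)
    also have "\<dots> \<le> minimax_estimation_error p N s (c / 2 * rate p N s)"
      using c by (intro minimax_estimation_error_ge[OF Np \<eta> M0]) (auto simp: b_def)
    finally show "ennreal \<delta> \<le> minimax_estimation_error p N s (c / 2 * rate p N s)" .
  qed
qed

end
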